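(* Let $\Phi(z)\in\mathbb{R}(z)^{n\times n}$ be a spectrum with normal rank $\mathrm{rk}(\Phi)=r\le n$, $r\neq 0$. Let $\mathscr{A}_p,\mathscr{A}_z\subset\overline{\mathbb{C}}$ be weakly unmixed-symplectic regions, and let $W(z),W_1(z)\in\mathbb{R}(z)^{r\times n}$ be such that: 1. $W(z)$ and $W_1(z)$ are spectral factors of $\Phi(z)$, i.e. $\Phi(z)=W^*(z)W(z)=W_1^*(z)W_1(z)$; 2. $W(z)$ and $W_1(z)$ are analytic in $\mathscr{A}_p$, and $W^{-R}(z)$ and $W_1^{-R}(z)$ are analytic in $\mathscr{A}_z$; 3. $W(z)$ and $W_1(z)$ are stochastically minimal, i.e. $\delta_M(W)=\delta_M(W_1)=\tfrac12\delta_M(\Phi)$. Then $W_1(z)=TW(z)$ for some constant orthogonal matrix $T\in\mathbb{R}^{r\times r}$.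
   Context: $\overline{\mathbb{C}}=\mathbb{C}\cup\{\infty\}$ is the extended complex plane, and $\mathbb{F}(z)^{m\times n}$ is the set of $m\times n$ rational matrices with coefficients in the field $\mathbb{F}$ ($\mathbb{F}=\mathbb{R}$ or $\mathbb{C}$). For a rational matrix $G(z)\in\mathbb{C}(z)^{m\times n}$, $G^*(z):=[G(1/\overline{z})]^*$, where $^*$ on the right is the Hermitian conjugate of a matrix (so $G^*(z)=[G(1/z)]^\top$ if $G$ is real). The normal rank $\mathrm{rk}(G)$ is the rank of $G(z)$ for almost every $z\in\mathbb{C}$. A rational matrix is analytic in a region if all its entries are (regions may contain $\infty$). Smith-McMillan form: if $G(z)\in\mathbb{C}(z)^{m\times n}$ has normal rank $r$, then $G(z)=C(z)D(z)F(z)$, where $C(z)\in\mathbb{C}[z]^{m\times r}$ and $F(z)\in\mathbb{C}[z]^{r\times n}$ are unimodular (i.e. possess a polynomial left inverse and a polynomial right inverse, respectively), and $D(z)=\mathrm{diag}[\varepsilon_1/\psi_1,\dots,\varepsilon_r/\psi_r]$, with $\varepsilon_i,\psi_i$ monic polynomials, $\varepsilon_i,\psi_i$ relatively prime for each $i$, $\varepsilon_i\mid\varepsilon_{i+1}$ and $\psi_{i+1}\mid\psi_i$; $D(z)$ is uniquely determined by $G$. The finite zeroes of $G$ are the zeroes of $\varepsilon_r$ and the finite poles of $G$ are the zeroes of $\psi_1$. For $\alpha\in\mathbb{C}$, the pole degree $\delta_p(G;\alpha)$ is the sum over $i$ of the multiplicities of $\alpha$ as a zero of $\psi_i$, and the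 zero degree $\delta_z(G;\alpha)$ is the sum over $i$ of the multiplicities of $\alpha$ as a zero of $\varepsilon_i$. For $\alpha=\infty$, poles, zeroes and their degrees are those at $\lambda=0$ after the change of variable $z=\lambda^{-1}$. The McMillan degree is $\delta_M(G):=\sum_{i}\delta_p(G;p_i)$, the sum over the distinct poles $p_i\in\overline{\mathbb{C}}$ of $G$ (the pole at infinity included). Minimal right inverse: if $G(z)\in\mathbb{C}(z)^{m\times n}$ has normal rank $m$, $G^{-R}(z)$ denotes a rational right inverse of $G(z)$ whose poles coincide with the zeroes of $G(z)$. Spectrum: a matrix $\Phi(z)\in\mathbb{R}(z)^{n\times n}$ which is para-Hermitian, i.e. $\Phi(z)=\Phi^*(z)$, and such that $\Phi(e^{j\omega})$ ($j$ the imaginary unit) is positive semi-definite for all $\omega\in[0,2\pi)$ for which $\Phi(e^{j\omega})$ is defined. Spectral factor of $\Phi$: a real rational matrix $W(z)$ with $\Phi(z)=W^*(z)W(z)$; it is stochastically minimal if $\delta_M(W)=\tfrac12\delta_M(\Phi)$. Weakly unmixed-symplectic: a set $\mathscr{A}\subset\overline{\mathbb{C}}$ such that $\mathscr{A}\cup\mathscr{A}^*=\overline{\mathbb{C}}$ and $\mathscr{A}\cap\mathscr{A}^*=\{z\in\mathbb{C}:|z|=1\}$, where $\mathscr{A}^*=\{z: z^{-1}\in\mathscr{A}\}$ (with $0^{-1}=\infty$, $\infty^{-1}=0$). *)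

theory Defs
  imports
    "HOL-Analysis.Analysis"
    "HOL-Computational_Algebra.Computational_Algebra"
    "HOL-Computational_Algebra.Field_as_Ring"
    "Jordan_Normal_Form.DL_Rank"
    "Jordan_Normal_Form.Schur_Decomposition"
begin

text \<open>
  Matrices are those of \<open>Jordan_Normal_Form\<close>; the rational matrices are the matrices over the
  fraction field of \<open>\<complex>[z]\<close>, and the real ones among them are singled out by a predicate.
\<close>

type_synonym ratfun = "complex poly fract"

type_synonym ratmat = "ratfun Matrix.mat"

definition real_ratfun :: "ratfun \<Rightarrow> bool" where
  "real_ratfun f \<longleftrightarrow> (\<exists>p q :: real poly. q \<noteq> 0 \<and>
     f = Fraction_Field.Fract (map_poly complex_of_real p) (map_poly complex_of_real q))"

definition real_ratmat :: "ratmat \<Rightarrow> bool" where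
  "real_ratmat G \<longleftrightarrow> (\<forall>i<dim_row G. \<forall>j<dim_col G. real_ratfun (G $$ (i, j)))"

definition const_ratfun :: "complex \<Rightarrow> ratfun" where
  "const_ratfun c = to_fract [:c:]"

definition ratfun_z :: ratfun where
  "ratfun_z = to_fract [:0, 1:]"


subsection \<open>Evaluation, normal rank\<close>

text \<open>
  \<open>quot_of_fract\<close> yields a coprime numerator/denominator pair, so the denominator below
  vanishes exactly at the finite poles; there the value is the junk value 0.
\<close>

definition eval_ratfun :: "ratfun \<Rightarrow> complex \<Rightarrow> complex" where
  "eval_ratfun f z = poly (fst (quot_of_fract f)) z / poly (snd (quot_of_fract f)) z"

definition eval_ratmat :: "ratmat \<Rightarrow> complex \<Rightarrow> complex Matrix.mat" where
  "eval_ratmat G z = map_mat (\<lambda>f. eval_ratfun f z) G"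

definition normal_rank :: "ratmat \<Rightarrow> nat" where
  "normal_rank G = (THE r. AE z in (lborel :: complex measure).
     vec_space.rank (dim_row G) (eval_ratmat G z) = r)"


subsection \<open>The operations \<open>f(1/z)\<close> and \<open>G\<^sup>*\<close>\<close>

text \<open>\<open>f(1/z)\<close>: numerator and denominator are evaluated at the element \<open>1/z\<close> of \<open>\<complex>(z)\<close>.\<close>

definition ratfun_recip :: "ratfun \<Rightarrow> ratfun" where
  "ratfun_recip f =
     poly (map_poly const_ratfun (fst (quot_of_fract f))) (1 / ratfun_z) /
     poly (map_poly const_ratfun (snd (quot_of_fract f))) (1 / ratfun_z)"

definition ratmat_recip :: "ratmat \<Rightarrow> ratmat" where
  "ratmat_recip G = map_mat ratfun_recip G"

text \<open>The rational function with values \<open>cnj (f (cnj z))\<close>.\<close>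

definition ratfun_cnj :: "ratfun \<Rightarrow> ratfun" where
  "ratfun_cnj f = Fraction_Field.Fract
     (map_poly cnj (fst (quot_of_fract f))) (map_poly cnj (snd (quot_of_fract f)))"

text \<open>
  Entrywise, \<open>G\<^sup>*\<close> has the values \<open>cnj (G\<^sub>j\<^sub>i (1 / cnj z))\<close>; see \<open>eval_ratfun_recip_cnj\<close> below.
\<close>

definition para_adjoint :: "ratmat \<Rightarrow> ratmat" where
  "para_adjoint G = Matrix.mat (dim_col G) (dim_row G)
     (\<lambda>(i, j). ratfun_recip (ratfun_cnj (G $$ (j, i))))"


subsection \<open>The extended complex plane, analyticity\<close>

datatype ecomplex = Fin complex | Inf

fun einverse :: "ecomplex \<Rightarrow> ecomplex" where
  "einverse (Fin z) = (if z = 0 then Inf else Fin (1 / z))"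
| "einverse Inf = Fin 0"

definition star_set :: "ecomplex set \<Rightarrow> ecomplex set" where
  "star_set A = {z. einverse z \<in> A}"

definition weakly_unmixed_symplectic :: "ecomplex set \<Rightarrow> bool" where
  "weakly_unmixed_symplectic A \<longleftrightarrow>
     A \<union> star_set A = UNIV \<and> A \<inter> star_set A = Fin ` {z. cmod z = 1}"

fun ratfun_analytic_at :: "ratfun \<Rightarrow> ecomplex \<Rightarrow> bool" where
  "ratfun_analytic_at f (Fin a) \<longleftrightarrow> eval_ratfun f analytic_on {a}"
| "ratfun_analytic_at f Inf \<longleftrightarrow> eval_ratfun (ratfun_recip f) analytic_on {0}"

definition ratmat_analytic_on :: "ratmat \<Rightarrow> ecomplex set \<Rightarrow> bool" where
  "ratmat_analytic_on G A \<longleftrightarrow>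
     (\<forall>\<alpha>\<in>A. \<forall>i<dim_row G. \<forall>j<dim_col G. ratfun_analytic_at (G $$ (i, j)) \<alpha>)"


subsection \<open>Smith-McMillan form, poles, zeroes and degrees\<close>

definition left_invertible_polymat :: "complex poly Matrix.mat \<Rightarrow> bool" where
  "left_invertible_polymat C \<longleftrightarrow>
     (\<exists>L \<in> carrier_mat (dim_col C) (dim_row C). L * C = 1\<^sub>m (dim_col C))"

definition right_invertible_polymat :: "complex poly Matrix.mat \<Rightarrow> bool" where
  "right_invertible_polymat F \<longleftrightarrow>
     (\<exists>R \<in> carrier_mat (dim_col F) (dim_row F). F * R = 1\<^sub>m (dim_row F))"

definition is_smith_mcmillan :: "ratmat \<Rightarrow> complex poly list \<Rightarrow> complex poly list \<Rightarrow> bool" where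
  "is_smith_mcmillan G \<epsilon> \<psi> \<longleftrightarrow>
     (let r = normal_rank G in
       length \<epsilon> = r \<and> length \<psi> = r \<and>
       (\<forall>i<r. lead_coeff (\<epsilon> ! i) = 1 \<and> lead_coeff (\<psi> ! i) = 1 \<and> coprime (\<epsilon> ! i) (\<psi> ! i)) \<and>
       (\<forall>i. Suc i < r \<longrightarrow> \<epsilon> ! i dvd \<epsilon> ! Suc i \<and> \<psi> ! Suc i dvd \<psi> ! i) \<and>
       (\<exists>C \<in> carrier_mat (dim_row G) r. \<exists>F \<in> carrier_mat r (dim_col G).
          left_invertible_polymat C \<and> right_invertible_polymat F \<and>
          G = map_mat to_fract C *
              Matrix.mat r r (\<lambda>(i, j). if i = j then Fraction_Field.Fract (\<epsilon> ! i) (\<psi> ! i) else 0) *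
              map_mat to_fract F))"

text \<open>The form exists and is unique, so the choice below is harmless.\<close>

definition smith_mcmillan :: "ratmat \<Rightarrow> complex poly list \<times> complex poly list" where
  "smith_mcmillan G = (SOME (\<epsilon>, \<psi>). is_smith_mcmillan G \<epsilon> \<psi>)"

definition sm_num :: "ratmat \<Rightarrow> complex poly list" where
  "sm_num G = fst (smith_mcmillan G)"

definition sm_den :: "ratmat \<Rightarrow> complex poly list" where
  "sm_den G = snd (smith_mcmillan G)"

text \<open>
  The diagonal is empty for \<open>G = 0\<close>, which then has neither poles nor zeroes. The point \<open>Inf\<close> is
  treated as \<open>0\<close> after the change of variable \<open>z = 1/\<lambda>\<close>.
\<close>

primrec is_ratmat_zero :: "ratmat \<Rightarrow> ecomplex \<Rightarrow> bool" where
  "is_ratmat_zero G (Fin a) \<longleftrightarrow> sm_num G \<noteq> [] \<and> poly (last (sm_num G)) a = 0"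
| "is_ratmat_zero G Inf \<longleftrightarrow>
     sm_num (ratmat_recip G) \<noteq> [] \<and> poly (last (sm_num (ratmat_recip G))) 0 = 0"

primrec is_ratmat_pole :: "ratmat \<Rightarrow> ecomplex \<Rightarrow> bool" where
  "is_ratmat_pole G (Fin a) \<longleftrightarrow> sm_den G \<noteq> [] \<and> poly (hd (sm_den G)) a = 0"
| "is_ratmat_pole G Inf \<longleftrightarrow>
     sm_den (ratmat_recip G) \<noteq> [] \<and> poly (hd (sm_den (ratmat_recip G))) 0 = 0"

primrec pole_degree :: "ratmat \<Rightarrow> ecomplex \<Rightarrow> nat" where
  "pole_degree G (Fin a) = (\<Sum>p\<leftarrow>sm_den G. Polynomial.order a p)"
| "pole_degree G Inf = (\<Sum>p\<leftarrow>sm_den (ratmat_recip G). Polynomial.order 0 p)"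

definition mcmillan_degree :: "ratmat \<Rightarrow> nat" where
  "mcmillan_degree G = (\<Sum>\<alpha> | is_ratmat_pole G \<alpha>. pole_degree G \<alpha>)"

definition minimal_right_inverse :: "ratmat \<Rightarrow> ratmat \<Rightarrow> bool" where
  "minimal_right_inverse G V \<longleftrightarrow>
     V \<in> carrier_mat (dim_col G) (dim_row G) \<and> G * V = 1\<^sub>m (dim_row G) \<and>
     (\<forall>\<alpha>. is_ratmat_pole V \<alpha> \<longleftrightarrow> is_ratmat_zero G \<alpha>)"


subsection \<open>Spectra and spectral factors\<close>

definition psd_mat :: "complex Matrix.mat \<Rightarrow> bool" where
  "psd_mat A \<longleftrightarrow> mat_adjoint A = A \<and>
     (\<forall>v \<in> carrier_vec (dim_col A). 0 \<le> Re ((A *\<^sub>v v) \<bullet>c v))"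

definition is_spectrum :: "nat \<Rightarrow> ratmat \<Rightarrow> bool" where
  "is_spectrum n \<Phi> \<longleftrightarrow> \<Phi> \<in> carrier_mat n n \<and> real_ratmat \<Phi> \<and> para_adjoint \<Phi> = \<Phi> \<and>
     (\<forall>\<omega> \<in> {0..<2 * pi}. ratmat_analytic_on \<Phi> {Fin (cis \<omega>)} \<longrightarrow>
        psd_mat (eval_ratmat \<Phi> (cis \<omega>)))"

definition spectral_factor :: "ratmat \<Rightarrow> ratmat \<Rightarrow> bool" where
  "spectral_factor \<Phi> W \<longleftrightarrow> real_ratmat W \<and> \<Phi> = para_adjoint W * W"

definition stochastically_minimal :: "ratmat \<Rightarrow> ratmat \<Rightarrow> bool" where
  "stochastically_minimal \<Phi> W \<longleftrightarrow>
     real (mcmillan_degree W) = 1 / 2 * real (mcmillan_degree \<Phi>)"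


subsection \<open>Values of the transformed functions\<close>

lemma snd_quot_of_fract_Fract_dvd:
  assumes "(q :: complex poly) \<noteq> 0"
  shows "snd (quot_of_fract (Fraction_Field.Fract p q)) dvd q"
proof -
  define f where "f = Fraction_Field.Fract p q"
  define a b where "a = fst (quot_of_fract f)" and "b = snd (quot_of_fract f)"
  have "Fraction_Field.Fract a b = f"
    unfolding a_def b_def by (rule Fract_quot_of_fract)
  hence "a * q = p * b"
    using assms by (simp add: f_def b_def eq_fract)
  hence "b dvd a * q" by simp
  moreover have "coprime a b"
    unfolding a_def b_def by (rule coprime_quot_of_fract)
  ultimately show ?thesis
    unfolding f_def[symmetric] b_def[symmetric]
    by (metis coprime_commute coprime_dvd_mult_right_iff)
qed

lemma eval_ratfun_Fract:
  assumes "poly q z \<noteq> 0"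
  shows "eval_ratfun (Fraction_Field.Fract p q) z = poly p z / poly q z"
proof -
  define f where "f = Fraction_Field.Fract p q"
  define a b where "a = fst (quot_of_fract f)" and "b = snd (quot_of_fract f)"
  have q: "q \<noteq> 0" using assms by auto
  have "Fraction_Field.Fract a b = f"
    unfolding a_def b_def by (rule Fract_quot_of_fract)
  hence "a * q = p * b"
    using q by (simp add: f_def b_def eq_fract)
  hence "poly a z * poly q z = poly p z * poly b z" by (metis poly_mult)
  moreover have "b dvd q"
    unfolding b_def f_def by (rule snd_quot_of_fract_Fract_dvd[OF q])
  hence "poly b z \<noteq> 0"
    using assms by (metis dvd_trans poly_eq_0_iff_dvd)
  ultimately show ?thesis
    using assms unfolding eval_ratfun_def f_def[symmetric] a_def[symmetric] b_def[symmetric]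
    by (simp add: frac_eq_eq)
qed

lemma poly_const_ratfun_recip:
  "\<exists>u k. poly (map_poly const_ratfun p) (1 / ratfun_z) = Fraction_Field.Fract u (monom 1 k) \<and>
     (\<forall>z. z \<noteq> 0 \<longrightarrow> poly u z / z ^ k = poly p (1 / z))"
proof (induction p)
  case 0
  show ?case
    by (rule exI[of _ 0], rule exI[of _ 0]) (simp add: fract_collapse)
next
  case (pCons a p)
  then obtain u k where u: "poly (map_poly const_ratfun p) (1 / ratfun_z) =
      Fraction_Field.Fract u (monom 1 k)"
    and v: "\<And>z. z \<noteq> 0 \<Longrightarrow> poly u z / z ^ k = poly p (1 / z)" by blast
  have z: "1 / ratfun_z = Fraction_Field.Fract 1 [:0, 1:]"
    by (simp add: ratfun_z_def to_fract_def One_fract_def)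
  have "poly (map_poly const_ratfun (pCons a p)) (1 / ratfun_z) =
      Fraction_Field.Fract [:a:] 1 + Fraction_Field.Fract 1 [:0, 1:] * Fraction_Field.Fract u (monom 1 k)"
    using pCons(1) u z by (simp add: map_poly_pCons const_ratfun_def to_fract_def)
  also have "\<dots> = Fraction_Field.Fract ([:a:] * monom 1 (Suc k) + u) (monom 1 (Suc k))"
    by (simp add: monom_Suc)
  finally have "poly (map_poly const_ratfun (pCons a p)) (1 / ratfun_z) =
      Fraction_Field.Fract ([:a:] * monom 1 (Suc k) + u) (monom 1 (Suc k))" .
  moreover have "poly ([:a:] * monom 1 (Suc k) + u) z / z ^ Suc k = poly (pCons a p) (1 / z)"
    if "z \<noteq> 0" for z
  proof -
    have "poly ([:a:] * monom 1 (Suc k) + u) z / z ^ Suc k = a + poly u z / z ^ k / z"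
      using that by (simp add: poly_monom add_divide_distrib)
    thus ?thesis by (simp add: v[OF that])
  qed
  ultimately show ?case by blast
qed

lemma eval_ratfun_recip:
  assumes z: "z \<noteq> 0" and q: "poly (snd (quot_of_fract f)) (1 / z) \<noteq> 0"
  shows "eval_ratfun (ratfun_recip f) z = eval_ratfun f (1 / z)"
proof -
  obtain u k where u: "poly (map_poly const_ratfun (fst (quot_of_fract f))) (1 / ratfun_z) =
      Fraction_Field.Fract u (monom 1 k)"
    and u': "poly u z / z ^ k = poly (fst (quot_of_fract f)) (1 / z)"
    using poly_const_ratfun_recip z by blast
  obtain v l where v: "poly (map_poly const_ratfun (snd (quot_of_fract f))) (1 / ratfun_z) =
      Fraction_Field.Fract v (monom 1 l)"
    and v': "poly v z / z ^ l = poly (snd (quot_of_fract f)) (1 / z)"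
    using poly_const_ratfun_recip z by blast
  have "poly v z \<noteq> 0" using v' q by auto
  moreover have "ratfun_recip f = Fraction_Field.Fract (u * monom 1 l) (monom 1 k * v)"
    by (simp add: ratfun_recip_def u v)
  ultimately have "eval_ratfun (ratfun_recip f) z = (poly u z / z ^ k) / (poly v z / z ^ l)"
    using z by (simp add: eval_ratfun_Fract poly_monom)
  thus ?thesis by (simp add: u' v' eval_ratfun_def)
qed

lemma eval_ratfun_recip_cnj:
  assumes z: "z \<noteq> 0" and q: "poly (snd (quot_of_fract f)) (1 / cnj z) \<noteq> 0"
  shows "eval_ratfun (ratfun_recip (ratfun_cnj f)) z = cnj (eval_ratfun f (1 / cnj z))"
proof -
  have cnj_poly: "poly (map_poly cnj p) w = cnj (poly p (cnj w))" for p w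
    by (induction p) (auto simp: map_poly_pCons)
  have nz: "poly (map_poly cnj (snd (quot_of_fract f))) (1 / z) \<noteq> 0"
    using q by (simp add: cnj_poly)
  hence "map_poly cnj (snd (quot_of_fract f)) \<noteq> 0" by auto
  hence "snd (quot_of_fract (ratfun_cnj f)) dvd map_poly cnj (snd (quot_of_fract f))"
    unfolding ratfun_cnj_def by (rule snd_quot_of_fract_Fract_dvd)
  hence "poly (snd (quot_of_fract (ratfun_cnj f))) (1 / z) \<noteq> 0"
    using nz by (metis dvd_trans poly_eq_0_iff_dvd)
  hence "eval_ratfun (ratfun_recip (ratfun_cnj f)) z = eval_ratfun (ratfun_cnj f) (1 / z)"
    by (rule eval_ratfun_recip[OF z])
  also have "\<dots> = cnj (eval_ratfun f (1 / cnj z))"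
    using nz by (simp add: ratfun_cnj_def eval_ratfun_Fract) (simp add: cnj_poly eval_ratfun_def)
  finally show ?thesis .
qed

end

theory Submission
  imports Defs
begin

text \<open>
  Put \<open>G\<^sup>~(z) = G(1/z)\<^sup>T\<close>, which is \<open>G\<^sup>*\<close> for real \<open>G\<close>. From \<open>W\<^sub>1\<^sup>~ W\<^sub>1 = W\<^sup>~ W\<close> and the right
  inverses \<open>V, V\<^sub>1\<close> one gets \<open>W\<^sub>1 = S W\<close> and \<open>W = S\<^sup>~ W\<^sub>1\<close> with \<open>S = W\<^sub>1 V = V\<^sub>1\<^sup>~ W\<^sup>~\<close> and \<open>S\<^sup>~ =
  W V\<^sub>1\<close> (\<open>spectral_factor_quotient\<close>). In particular \<open>S\<^sup>~ S = 1\<close>, and \<open>S\<close> is real because \<open>W\<close> and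
  \<open>W\<^sub>1\<close> are. So it suffices that \<open>S\<close> has no poles on the extended plane, for then it is constant
  (\<open>regular_everywhere_const\<close>). Since \<open>A\<^sub>p\<close> and its reflection cover the plane, and the reflection
  exchanges \<open>S\<close> and \<open>S\<^sup>~\<close>, it is enough that both are regular at every \<open>\<alpha> \<in> A\<^sub>p\<close>.

  At such a point \<open>W\<close> and \<open>W\<^sub>1\<close> are regular. If \<open>\<alpha> \<in> A\<^sub>z\<close>, then so are \<open>V\<close> and \<open>V\<^sub>1\<close>, and hence \<open>S
  = W\<^sub>1 V\<close> and \<open>S\<^sup>~ = W V\<^sub>1\<close>. Otherwise \<open>1/\<alpha> \<in> A\<^sub>z\<close>, so that \<open>V\<^sup>~\<close> and \<open>V\<^sub>1\<^sup>~\<close> are regular at \<open>\<alpha>\<close>;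
  here stochastic minimality is needed. The pole degree of \<open>\<Phi> = W\<^sup>~ W\<close> at a point where \<open>W\<close> is
  regular is at most that of \<open>W\<^sup>~\<close>. By the symmetry \<open>\<Phi>\<^sup>~ = \<Phi>\<close> this also bounds the pole degrees
  outside \<open>A\<^sub>p\<close>, and the sum of these inequalities over all poles is \<open>\<delta>\<^sub>M(\<Phi>) \<le> 2 \<delta>\<^sub>M(W)\<close>, which is
  an equality by hypothesis, so each of them is an equality (\<open>minimal_pole_degree\<close>). Equality at
  \<open>\<alpha>\<close> means that \<open>W\<^sup>~\<close> and \<open>W\<^sup>~ W\<close> generate the same lattice over the local ring of \<open>\<alpha>\<close>, modulo
  regular vectors, i.e. \<open>W\<^sup>~ = W\<^sup>~ W Y + Z\<close> with regular \<open>Y, Z\<close> (\<open>pole_degree_mult_eq\<close>).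
  Substituting \<open>W\<^sup>~ W = W\<^sub>1\<^sup>~ W\<^sub>1\<close> yields \<open>S = V\<^sub>1\<^sup>~ W\<^sup>~ = W\<^sub>1 Y + V\<^sub>1\<^sup>~ Z\<close>, which is regular
  (\<open>spectral_factor_quotient_regular\<close>); \<open>S\<^sup>~\<close> is treated in the same way.

  The local statement about pole degrees rests on left denominators: regular square matrices \<open>D\<close>
  with \<open>D X\<close> regular and \<open>D X A + D B = 1\<close> for some regular \<open>A, B\<close>. The Smith-McMillan form, whose
  existence is \<open>is_smith_mcmillan_exists\<close>, provides one whose determinant has the pole degree of
  \<open>X\<close> as its order of vanishing (\<open>left_denominator_exists\<close>). A left denominator of \<open>M\<close> is a
  regular multiple \<open>E D'\<close> of one of \<open>M W\<close> if \<open>W\<close> is regular, and when the orders of the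
  determinants agree, \<open>E\<close> is invertible over the local ring.
\<close>

section \<open>Rational functions\<close>

lemma const_ratfun_hom: "inj_ring_hom const_ratfun"
  by unfold_locales
     (auto simp: const_ratfun_def one_pCons[symmetric] simp flip: to_fract_add to_fract_mult)

interpretation const_ratfun: inj_ring_hom const_ratfun
  by (rule const_ratfun_hom)

lemma ratfun_z_nonzero: "ratfun_z \<noteq> 0"
  by (simp add: ratfun_z_def)

text \<open>The substitution of \<open>1/z\<close> for \<open>z\<close> in a polynomial.\<close>

definition poly_recip :: "complex poly \<Rightarrow> ratfun" where
  "poly_recip p = poly (map_poly const_ratfun p) (1 / ratfun_z)"

lemma poly_recip_add: "poly_recip (p + q) = poly_recip p + poly_recip q"
proof -
  interpret comm_ring_hom const_ratfun by unfold_locales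
  interpret m: map_poly_comm_ring_hom const_ratfun ..
  show ?thesis by (simp add: poly_recip_def m.hom_add)
qed

lemma poly_recip_mult: "poly_recip (p * q) = poly_recip p * poly_recip q"
proof -
  interpret comm_ring_hom const_ratfun by unfold_locales
  interpret m: map_poly_comm_ring_hom const_ratfun ..
  show ?thesis by (simp add: poly_recip_def m.hom_mult)
qed

lemma poly_recip_pCons: "poly_recip (pCons a p) = const_ratfun a + poly_recip p / ratfun_z"
  using Polynomial.map_poly_pCons[of const_ratfun a p] by (simp add: poly_recip_def)

lemma poly_recip_0 [simp]: "poly_recip 0 = 0"
  by (simp add: poly_recip_def)

lemma poly_recip_1 [simp]: "poly_recip 1 = 1"
  by (simp add: poly_recip_def)

lemma poly_recip_nonzero:
  assumes "p \<noteq> 0"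
  shows "poly_recip p \<noteq> 0"
proof
  assume 0: "poly_recip p = 0"
  obtain u k where u: "poly_recip p = Fraction_Field.Fract u (monom 1 k)"
    and v: "\<And>z. z \<noteq> 0 \<Longrightarrow> poly u z / z ^ k = poly p (1 / z)"
    using poly_const_ratfun_recip[of p] unfolding poly_recip_def by blast
  have "u = 0"
    using 0 u by (simp add: Fract_conv_to_fract)
  hence "poly p z = 0" if "z \<noteq> 0" for z
    using v[of "1 / z"] that by simp
  hence "UNIV - {0} \<subseteq> {z. poly p z = 0}" by auto
  hence "finite (UNIV - {0 :: complex})"
    using poly_roots_finite[OF assms] finite_subset by blast
  thus False
    by (simp add: infinite_UNIV_char_0)
qed

lemma ratfun_recip_Fract:
  assumes "q \<noteq> 0"
  shows "ratfun_recip (Fraction_Field.Fract p q) = poly_recip p / poly_recip q"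
proof -
  define f where "f = Fraction_Field.Fract p q"
  define a b where "a = fst (quot_of_fract f)" and "b = snd (quot_of_fract f)"
  have b: "b \<noteq> 0" by (simp add: b_def)
  have "Fraction_Field.Fract a b = f"
    unfolding a_def b_def by (rule Fract_quot_of_fract)
  hence "a * q = p * b"
    using assms b by (simp add: f_def eq_fract)
  hence "poly_recip a * poly_recip q = poly_recip p * poly_recip b"
    by (metis poly_recip_mult)
  thus ?thesis
    unfolding f_def[symmetric] ratfun_recip_def a_def[symmetric] b_def[symmetric]
      poly_recip_def[symmetric]
    using poly_recip_nonzero[OF b] poly_recip_nonzero[OF assms] by (simp add: frac_eq_eq)
qed

lemma ratfun_recip_hom: "field_hom ratfun_recip"
proof
  show "ratfun_recip 0 = 0"
    using ratfun_recip_Fract[of 1 0] by (simp add: fract_collapse)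
  show "ratfun_recip 1 = 1"
    using ratfun_recip_Fract[of 1 1] by (simp add: fract_collapse)
  fix f g :: ratfun
  obtain a b where f: "f = Fraction_Field.Fract a b" "b \<noteq> 0" by (cases f) auto
  obtain c d where g: "g = Fraction_Field.Fract c d" "d \<noteq> 0" by (cases g) auto
  note nz = poly_recip_nonzero[OF f(2)] poly_recip_nonzero[OF g(2)]
  show "ratfun_recip (f + g) = ratfun_recip f + ratfun_recip g"
    using f(2) g(2) nz
    by (simp add: f(1) g(1) ratfun_recip_Fract poly_recip_mult poly_recip_add field_simps)
  show "ratfun_recip (f * g) = ratfun_recip f * ratfun_recip g"
    using f(2) g(2) nz
    by (simp add: f(1) g(1) ratfun_recip_Fract poly_recip_mult)
qed

interpretation ratfun_recip: field_hom ratfun_recip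
  by (rule ratfun_recip_hom)

lemma ratfun_recip_const [simp]: "ratfun_recip (const_ratfun c) = const_ratfun c"
  using ratfun_recip_Fract[of 1 "[:c:]"]
  by (simp add: const_ratfun_def to_fract_def poly_recip_pCons)

lemma ratfun_recip_z: "ratfun_recip ratfun_z = 1 / ratfun_z"
  using ratfun_recip_Fract[of 1 "[:0, 1:]"]
  by (simp add: ratfun_z_def to_fract_def poly_recip_pCons)

lemma ratfun_recip_poly_recip: "ratfun_recip (poly_recip p) = to_fract p"
proof (induction p)
  case (pCons a p)
  have "to_fract (pCons a p) = to_fract ([:a:] + [:0, 1:] * p)" by simp
  also have "\<dots> = const_ratfun a + ratfun_z * to_fract p"
    by (simp only: to_fract_add to_fract_mult const_ratfun_def ratfun_z_def)
  also have "\<dots> = ratfun_recip (poly_recip (pCons a p))"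
    by (simp add: poly_recip_pCons ratfun_recip.hom_add ratfun_recip.hom_div ratfun_recip_z pCons)
  finally show ?case ..
qed simp

lemma ratfun_recip_recip [simp]: "ratfun_recip (ratfun_recip f) = f"
proof -
  obtain a b where f: "f = Fraction_Field.Fract a b" "b \<noteq> 0" by (cases f) auto
  thus ?thesis
    by (simp add: ratfun_recip_Fract ratfun_recip.hom_div ratfun_recip_poly_recip)
       (simp add: Fract_conv_to_fract)
qed


subsection \<open>Complex conjugation of the coefficients\<close>

lemma ratfun_cnj_Fract:
  assumes "q \<noteq> 0"
  shows "ratfun_cnj (Fraction_Field.Fract p q) =
    Fraction_Field.Fract (map_poly cnj p) (map_poly cnj q)"
proof -
  interpret cnj: inj_comm_ring_hom cnj by unfold_locales auto
  interpret m: map_poly_inj_comm_ring_hom cnj ..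
  define f where "f = Fraction_Field.Fract p q"
  define a b where "a = fst (quot_of_fract f)" and "b = snd (quot_of_fract f)"
  have b: "b \<noteq> 0" by (simp add: b_def)
  have "Fraction_Field.Fract a b = f"
    unfolding a_def b_def by (rule Fract_quot_of_fract)
  hence "a * q = p * b"
    using assms b by (simp add: f_def eq_fract)
  hence "map_poly cnj a * map_poly cnj q = map_poly cnj p * map_poly cnj b"
    by (metis m.hom_mult)
  thus ?thesis
    unfolding f_def[symmetric] ratfun_cnj_def a_def[symmetric] b_def[symmetric]
    using assms b by (simp add: eq_fract)
qed

lemma ratfun_cnj_hom: "field_hom ratfun_cnj"
proof -
  interpret cnj: inj_comm_ring_hom cnj by unfold_locales auto
  interpret m: map_poly_inj_comm_ring_hom cnj ..
  show ?thesis
  proof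
    show "ratfun_cnj 0 = 0"
      using ratfun_cnj_Fract[of 1 0] by (simp add: fract_collapse)
    show "ratfun_cnj 1 = 1"
      using ratfun_cnj_Fract[of 1 1] by (simp add: fract_collapse)
    fix f g :: ratfun
    obtain a b where f: "f = Fraction_Field.Fract a b" "b \<noteq> 0" by (cases f) auto
    obtain c d where g: "g = Fraction_Field.Fract c d" "d \<noteq> 0" by (cases g) auto
    show "ratfun_cnj (f + g) = ratfun_cnj f + ratfun_cnj g"
      using f(2) g(2) by (simp add: f(1) g(1) ratfun_cnj_Fract m.hom_add m.hom_mult)
    show "ratfun_cnj (f * g) = ratfun_cnj f * ratfun_cnj g"
      using f(2) g(2) by (simp add: f(1) g(1) ratfun_cnj_Fract m.hom_mult)
  qed
qed

interpretation ratfun_cnj: field_hom ratfun_cnj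
  by (rule ratfun_cnj_hom)

lemma ratfun_cnj_real:
  assumes "real_ratfun f"
  shows "ratfun_cnj f = f"
proof -
  obtain p q :: "real poly" where q: "q \<noteq> 0" and f: "f = Fraction_Field.Fract
      (map_poly complex_of_real p) (map_poly complex_of_real q)"
    using assms unfolding real_ratfun_def by blast
  have "map_poly complex_of_real q \<noteq> 0"
    using q by (simp add: map_poly_eq_0_iff)
  moreover have "map_poly cnj (map_poly complex_of_real r) = map_poly complex_of_real r" for r
    by (rule poly_eqI) (simp add: coeff_map_poly)
  ultimately show ?thesis
    by (simp add: f ratfun_cnj_Fract)
qed

lemma ratfun_cnj_const: "ratfun_cnj (const_ratfun c) = const_ratfun (cnj c)"
  using Polynomial.map_poly_pCons[of cnj c 0]
  by (simp add: const_ratfun_def to_fract_def ratfun_cnj_Fract)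


section \<open>Regularity and order at a point of the extended plane\<close>

text \<open>
  The local ring at a point: the functions without a pole there. Since numerator and denominator of
  \<open>quot_of_fract\<close> are coprime, the poles are the zeroes of the denominator.
\<close>

fun regular_at :: "ecomplex \<Rightarrow> ratfun \<Rightarrow> bool" where
  "regular_at (Fin a) f \<longleftrightarrow> poly (snd (quot_of_fract f)) a \<noteq> 0"
| "regular_at Inf f \<longleftrightarrow> poly (snd (quot_of_fract (ratfun_recip f))) 0 \<noteq> 0"

lemma regular_at_Inf: "regular_at Inf f \<longleftrightarrow> regular_at (Fin 0) (ratfun_recip f)"
  by simp

lemma regular_at_FinI:
  assumes "poly q a \<noteq> 0"
  shows "regular_at (Fin a) (Fraction_Field.Fract p q)"
proof -
  have "q \<noteq> 0" using assms by auto
  then obtain s where "q = snd (quot_of_fract (Fraction_Field.Fract p q)) * s"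
    using snd_quot_of_fract_Fract_dvd by (blast elim: dvdE)
  hence "poly q a = poly (snd (quot_of_fract (Fraction_Field.Fract p q))) a * poly s a"
    by (metis poly_mult)
  thus ?thesis using assms by auto
qed

lemma regular_at_FinE:
  assumes "regular_at (Fin a) f"
  obtains p q where "poly q a \<noteq> 0" "q \<noteq> 0" "f = Fraction_Field.Fract p q"
  using assms Fract_quot_of_fract[of f] snd_quot_of_fract_nonzero[of f] by (metis regular_at.simps(1))

lemma regular_at_to_fract [simp]: "regular_at (Fin a) (to_fract p)"
  by simp

lemma regular_at_ratfun_recip_imp:
  assumes "regular_at \<alpha> f"
  shows "regular_at (einverse \<alpha>) (ratfun_recip f)"
proof (cases \<alpha>)
  case Inf
  thus ?thesis using assms by simp
next
  case (Fin a)
  show ?thesis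
  proof (cases "a = 0")
    case True
    thus ?thesis using assms Fin by simp
  next
    case False
    obtain p q where q: "poly q a \<noteq> 0" "q \<noteq> 0" and f: "f = Fraction_Field.Fract p q"
      using assms unfolding Fin by (rule regular_at_FinE)
    obtain u k where u: "poly_recip p = Fraction_Field.Fract u (monom 1 k)"
      using poly_const_ratfun_recip[of p] unfolding poly_recip_def by blast
    obtain v l where v: "poly_recip q = Fraction_Field.Fract v (monom 1 l)"
      and v': "\<And>z. z \<noteq> 0 \<Longrightarrow> poly v z / z ^ l = poly q (1 / z)"
      using poly_const_ratfun_recip[of q] unfolding poly_recip_def by blast
    have "ratfun_recip f = Fraction_Field.Fract (u * monom 1 l) (monom 1 k * v)"
      using q(2) by (simp add: f ratfun_recip_Fract u v)
    moreover have "poly (monom 1 k * v) (1 / a) \<noteq> 0"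
      using v'[of "1 / a"] q(1) False by (auto simp: poly_monom)
    ultimately have "regular_at (Fin (1 / a)) (ratfun_recip f)"
      using regular_at_FinI by simp
    thus ?thesis using Fin False by simp
  qed
qed

lemma einverse_einverse [simp]: "einverse (einverse \<alpha>) = \<alpha>"
  by (cases \<alpha>) auto

lemma regular_at_ratfun_recip: "regular_at \<alpha> (ratfun_recip f) \<longleftrightarrow> regular_at (einverse \<alpha>) f"
  using regular_at_ratfun_recip_imp[of \<alpha> "ratfun_recip f"]
    regular_at_ratfun_recip_imp[of "einverse \<alpha>" f] by auto

lemma regular_at_const [simp]: "regular_at \<alpha> (const_ratfun c)"
proof -
  have *: "regular_at (Fin a) (const_ratfun c)" for a
    by (simp add: const_ratfun_def)
  hence "regular_at Inf (const_ratfun c)"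
    unfolding regular_at_Inf ratfun_recip_const by blast
  with * show ?thesis by (cases \<alpha>) blast+
qed

lemma regular_at_0 [simp]: "regular_at \<alpha> 0"
  and regular_at_1 [simp]: "regular_at \<alpha> 1"
  by (cases \<alpha>; simp)+

lemma regular_at_add: "regular_at \<alpha> f \<Longrightarrow> regular_at \<alpha> g \<Longrightarrow> regular_at \<alpha> (f + g)"
proof -
  have *: "regular_at (Fin a) (f + g)" if "regular_at (Fin a) f" "regular_at (Fin a) g" for a f g
    using that by (elim regular_at_FinE) (auto simp del: regular_at.simps intro!: regular_at_FinI)
  show "regular_at \<alpha> f \<Longrightarrow> regular_at \<alpha> g \<Longrightarrow> regular_at \<alpha> (f + g)"
    using * by (cases \<alpha>) (auto simp only: regular_at_Inf ratfun_recip.hom_add)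
qed

lemma regular_at_mult: "regular_at \<alpha> f \<Longrightarrow> regular_at \<alpha> g \<Longrightarrow> regular_at \<alpha> (f * g)"
proof -
  have *: "regular_at (Fin a) (f * g)" if "regular_at (Fin a) f" "regular_at (Fin a) g" for a f g
    using that by (elim regular_at_FinE) (auto simp del: regular_at.simps intro!: regular_at_FinI)
  show "regular_at \<alpha> f \<Longrightarrow> regular_at \<alpha> g \<Longrightarrow> regular_at \<alpha> (f * g)"
    using * by (cases \<alpha>) (auto simp only: regular_at_Inf ratfun_recip.hom_mult)
qed

lemma regular_at_uminus: "regular_at \<alpha> f \<Longrightarrow> regular_at \<alpha> (- f)"
  using regular_at_mult[of \<alpha> "const_ratfun (- 1)" f]
  by (metis const_ratfun.hom_one const_ratfun.hom_uminus mult_minus1 regular_at_const)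

lemma regular_at_sum: "(\<And>i. i \<in> A \<Longrightarrow> regular_at \<alpha> (f i)) \<Longrightarrow> regular_at \<alpha> (sum f A)"
  by (induction A rule: infinite_finite_induct) (auto simp: regular_at_add)

lemma regular_at_prod: "(\<And>i. i \<in> A \<Longrightarrow> regular_at \<alpha> (f i)) \<Longrightarrow> regular_at \<alpha> (prod f A)"
  by (induction A rule: infinite_finite_induct) (auto simp: regular_at_mult)

lemma regular_at_power: "regular_at \<alpha> f \<Longrightarrow> regular_at \<alpha> (f ^ k)"
  by (induction k) (auto simp: regular_at_mult)

text \<open>
  At a pole a continuous function cannot satisfy \<open>f \<cdot> q = p\<close> with \<open>p, q\<close> coprime, so a value
  assigned there, such as the 0 that comes from division by 0, does not make the function analytic.
\<close>

lemma regular_at_of_analytic: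
  assumes "ratfun_analytic_at f \<alpha>"
  shows "regular_at \<alpha> f"
proof -
  have *: "regular_at (Fin a) f" if an: "eval_ratfun f analytic_on {a}" for f a
  proof (rule ccontr)
    define p q where "p = fst (quot_of_fract f)" and "q = snd (quot_of_fract f)"
    have q: "q \<noteq> 0" by (simp add: q_def)
    assume "\<not> regular_at (Fin a) f"
    hence qa: "poly q a = 0" by (simp add: q_def)
    have "coprime p q" unfolding p_def q_def by (rule coprime_quot_of_fract)
    hence pa: "poly p a \<noteq> 0"
      using qa coprime_poly_0 by blast
    have "continuous (at a) (eval_ratfun f)"
      using analytic_on_imp_differentiable_at[OF an] field_differentiable_imp_continuous_at by blast
    hence "((\<lambda>z. eval_ratfun f z * poly q z) \<longlongrightarrow> eval_ratfun f a * poly q a) (at a)"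
      by (intro tendsto_intros) (auto simp: continuous_at)
    moreover have "\<forall>\<^sub>F z in at a. eval_ratfun f z * poly q z = poly p z"
    proof -
      have "finite {z. poly q z = 0}" using q by (rule poly_roots_finite)
      hence "open (- ({z. poly q z = 0} - {a}))"
        by (intro open_Compl finite_imp_closed) auto
      hence "\<forall>\<^sub>F z in at a. z \<in> - ({z. poly q z = 0} - {a})"
        by (rule eventually_at_in_open') simp
      moreover have "\<forall>\<^sub>F z in at a. z \<noteq> a"
        by (simp add: eventually_at_filter)
      ultimately show ?thesis
        by eventually_elim (auto simp: eval_ratfun_def p_def q_def)
    qed
    ultimately have "((\<lambda>z. poly p z) \<longlongrightarrow> eval_ratfun f a * poly q a) (at a)"
      by (rule Lim_transform_eventually)
    moreover have "((\<lambda>z. poly p z) \<longlongrightarrow> poly p a) (at a)"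
      by (intro tendsto_intros)
    ultimately have "eval_ratfun f a * poly q a = poly p a"
      by (rule tendsto_unique[rotated]) simp
    thus False using qa pa by simp
  qed
  show ?thesis
    using assms * by (cases \<alpha>) (auto simp: regular_at_Inf simp del: regular_at.simps)
qed

lemma to_fract_power: "to_fract (p ^ k) = to_fract p ^ k"
  by (induction k) auto

lemma to_fract_reflect_poly: "to_fract (reflect_poly p) = poly_recip p * ratfun_z ^ degree p"
proof (induction p rule: pCons_induct)
  case (pCons a p)
  show ?case
  proof (cases "p = 0")
    case True
    thus ?thesis by (simp add: poly_recip_pCons const_ratfun_def)
  next
    case False
    have "reflect_poly (pCons a p) = reflect_poly p + [:a:] * [:0, 1:] ^ Suc (degree p)"
      using False by (simp add: reflect_poly_pCons' smult_monom monom_altdef)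
    hence "to_fract (reflect_poly (pCons a p)) =
        to_fract (reflect_poly p) + const_ratfun a * ratfun_z ^ Suc (degree p)"
      by (simp only: to_fract_add to_fract_mult to_fract_power const_ratfun_def ratfun_z_def)
    thus ?thesis
      using False ratfun_z_nonzero by (simp add: pCons poly_recip_pCons field_simps)
  qed
qed simp

text \<open>Liouville's theorem for rational functions.\<close>

lemma regular_everywhere_const:
  assumes "\<And>\<alpha>. regular_at \<alpha> f"
  shows "\<exists>c. f = const_ratfun c"
proof -
  define p q where "p = fst (quot_of_fract f)" and "q = snd (quot_of_fract f)"
  have f: "f = Fraction_Field.Fract p q" by (simp add: p_def q_def)
  have "poly q a \<noteq> 0" for a
    using assms[of "Fin a"] by (simp add: q_def)
  hence "constant (poly q)"
    using fundamental_theorem_of_algebra by blast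
  hence "degree q = 0" by (simp add: constant_degree)
  then obtain c where c: "q = [:c:]" by (metis degree_eq_zeroE)
  have "c \<noteq> 0" using \<open>poly q 0 \<noteq> 0\<close> c by simp
  hence "f = to_fract (Polynomial.smult (1 / c) p)"
    unfolding f c to_fract_def by (simp add: eq_fract)
  then obtain g where g: "f = to_fract g" by blast
  have "degree g = 0"
  proof (rule ccontr)
    assume dg: "degree g \<noteq> 0"
    obtain h s where h: "ratfun_recip f = Fraction_Field.Fract h s" and s: "poly s 0 \<noteq> 0" "s \<noteq> 0"
      using assms[of Inf] unfolding regular_at_Inf by (rule regular_at_FinE)
    have "Fraction_Field.Fract h s = poly_recip g"
      using h g ratfun_recip_poly_recip[of g] by (metis ratfun_recip_recip)
    \<comment> \<open>At 0, \<open>reflect_poly g\<close> has the value \<open>lead_coeff g\<close>, but the right-hand side is 0.\<close>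
    hence "to_fract (reflect_poly g) * to_fract s = to_fract h * ratfun_z ^ degree g"
      using s(2) by (simp add: to_fract_reflect_poly Fract_conv_to_fract field_simps)
    hence "reflect_poly g * s = h * [:0, 1:] ^ degree g"
      by (simp add: ratfun_z_def flip: to_fract_mult to_fract_power)
    hence "poly (reflect_poly g) 0 * poly s 0 = poly h 0 * 0 ^ degree g"
      by (metis poly_mult poly_power poly_pCons poly_0 add_0 mult_zero_left mult.commute)
    thus False
      using dg s(1) by (auto simp: power_0_left)
  qed
  then obtain c where "g = [:c:]" by (metis degree_eq_zeroE)
  thus ?thesis using g unfolding const_ratfun_def by blast
qed


text \<open>A generator of the maximal ideal of the local ring.\<close>

fun uniformizer :: "ecomplex \<Rightarrow> ratfun" where
  "uniformizer (Fin a) = to_fract [:- a, 1:]"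
| "uniformizer Inf = 1 / ratfun_z"

text \<open>The units of the local ring.\<close>

definition unit_at :: "ecomplex \<Rightarrow> ratfun \<Rightarrow> bool" where
  "unit_at \<alpha> u \<longleftrightarrow> u \<noteq> 0 \<and> regular_at \<alpha> u \<and> regular_at \<alpha> (inverse u)"

text \<open>
  The discrete valuation of the local ring as a relation; \<open>k\<close> is unique by \<open>has_order_unique\<close>, and
  exists for every nonzero regular \<open>f\<close> by \<open>regular_has_order\<close>.
\<close>

definition has_order :: "ecomplex \<Rightarrow> ratfun \<Rightarrow> nat \<Rightarrow> bool" where
  "has_order \<alpha> f k \<longleftrightarrow> (\<exists>u. unit_at \<alpha> u \<and> f = uniformizer \<alpha> ^ k * u)"

lemma has_orderE:
  assumes "has_order \<alpha> f k"
  obtains u where "unit_at \<alpha> u" "f = uniformizer \<alpha> ^ k * u"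
  using assms unfolding has_order_def by metis

lemma uniformizer_nonzero: "uniformizer \<alpha> \<noteq> 0"
  by (cases \<alpha>) (auto simp: ratfun_z_nonzero)

lemma uniformizer_0: "uniformizer (Fin 0) = ratfun_z"
  by (simp add: ratfun_z_def)

lemma regular_at_uniformizer: "regular_at \<alpha> (uniformizer \<alpha>)"
proof (cases \<alpha>)
  case Inf
  have "ratfun_recip (uniformizer Inf) = ratfun_z"
    using ratfun_recip_z ratfun_recip_recip[of ratfun_z] by simp
  thus ?thesis
    unfolding Inf regular_at_Inf by (simp add: ratfun_z_def)
qed simp

lemma inverse_uniformizer_not_regular: "\<not> regular_at \<alpha> (inverse (uniformizer \<alpha>))"
proof -
  have *: "\<not> regular_at (Fin a) (inverse (uniformizer (Fin a)))" for a
  proof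
    assume "regular_at (Fin a) (inverse (uniformizer (Fin a)))"
    then obtain p q where q: "poly q a \<noteq> 0" "q \<noteq> 0"
      and "inverse (uniformizer (Fin a)) = Fraction_Field.Fract p q"
      by (rule regular_at_FinE)
    hence "to_fract q = to_fract p * uniformizer (Fin a)"
      using uniformizer_nonzero[of "Fin a"] by (simp add: Fract_conv_to_fract field_simps)
    hence "q = p * [:- a, 1:]"
      by (metis to_fract_eq_iff to_fract_mult uniformizer.simps(1))
    thus False using q by simp
  qed
  show ?thesis
  proof (cases \<alpha>)
    case Inf
    have "ratfun_recip (inverse (uniformizer Inf)) = inverse (uniformizer (Fin 0))"
      using ratfun_recip_z by (simp add: uniformizer_0 inverse_eq_divide del: uniformizer.simps(1))
    thus ?thesis
      using *[of 0] unfolding Inf regular_at_Inf by simp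
  qed (use * in blast)
qed

lemma unit_at_mult: "unit_at \<alpha> u \<Longrightarrow> unit_at \<alpha> v \<Longrightarrow> unit_at \<alpha> (u * v)"
  by (simp add: unit_at_def regular_at_mult)

lemma unit_at_inverse: "unit_at \<alpha> u \<Longrightarrow> unit_at \<alpha> (inverse u)"
  by (simp add: unit_at_def)

lemma unit_at_ratfun_recip: "unit_at \<alpha> (ratfun_recip u) \<longleftrightarrow> unit_at (einverse \<alpha>) u"
  by (simp add: unit_at_def regular_at_ratfun_recip flip: ratfun_recip.hom_inverse)

lemma unit_at_power: "unit_at \<alpha> u \<Longrightarrow> unit_at \<alpha> (u ^ k)"
  by (simp add: unit_at_def regular_at_power power_inverse[symmetric])

lemma has_order_unique:
  assumes "has_order \<alpha> f k" "has_order \<alpha> f l"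
  shows "k = l"
proof -
  have False if fk: "has_order \<alpha> f k" and fl: "has_order \<alpha> f l" and "k < l" for k l
  proof -
    obtain u where u: "unit_at \<alpha> u" "f = uniformizer \<alpha> ^ k * u"
      using fk by (rule has_orderE)
    obtain v where v: "unit_at \<alpha> v" "f = uniformizer \<alpha> ^ l * v"
      using fl by (rule has_orderE)
    obtain d where d: "l = k + Suc d" using \<open>k < l\<close> less_iff_Suc_add by auto
    have "uniformizer \<alpha> ^ k * u = uniformizer \<alpha> ^ k * (uniformizer \<alpha> * uniformizer \<alpha> ^ d * v)"
      unfolding u(2)[symmetric] unfolding v(2) d by (simp add: power_add mult_ac)
    hence "u = uniformizer \<alpha> * (uniformizer \<alpha> ^ d * v)"
      by (simp only: mult.assoc mult_left_cancel[OF power_not_zero[OF uniformizer_nonzero]])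
    moreover have "u \<noteq> 0" using u(1) by (simp add: unit_at_def)
    ultimately have "inverse (uniformizer \<alpha>) = inverse u * (uniformizer \<alpha> ^ d * v)"
      using uniformizer_nonzero[of \<alpha>] by (simp add: field_simps)
    moreover have "regular_at \<alpha> (inverse u * (uniformizer \<alpha> ^ d * v))"
      using u(1) v(1) by (intro regular_at_mult regular_at_power regular_at_uniformizer)
        (auto simp: unit_at_def)
    ultimately show False
      using inverse_uniformizer_not_regular[of \<alpha>] by metis
  qed
  thus ?thesis using assms by (metis linorder_neqE_nat)
qed

lemma has_order_mult: "has_order \<alpha> f k \<Longrightarrow> has_order \<alpha> g l \<Longrightarrow> has_order \<alpha> (f * g) (k + l)"
proof -
  assume f: "has_order \<alpha> f k" and g: "has_order \<alpha> g l"
  obtain u where u: "unit_at \<alpha> u" "f = uniformizer \<alpha> ^ k * u" using f by (rule has_orderE)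
  obtain v where v: "unit_at \<alpha> v" "g = uniformizer \<alpha> ^ l * v" using g by (rule has_orderE)
  have "f * g = uniformizer \<alpha> ^ (k + l) * (u * v)"
    by (simp add: u(2) v(2) power_add mult_ac)
  thus "has_order \<alpha> (f * g) (k + l)"
    using unit_at_mult[OF u(1) v(1)] unfolding has_order_def by blast
qed

lemma has_order_0_iff: "has_order \<alpha> f 0 \<longleftrightarrow> unit_at \<alpha> f"
  by (simp add: has_order_def)

text \<open>The reflection \<open>z \<mapsto> 1/z\<close> maps uniformizers to uniformizers, up to units.\<close>

lemma has_order_ratfun_recip:
  "has_order \<alpha> (ratfun_recip f) k \<longleftrightarrow> has_order (einverse \<alpha>) f k"
proof -
  have *: "\<exists>v. unit_at (einverse \<alpha>) v \<and> ratfun_recip (uniformizer \<alpha>) = uniformizer (einverse \<alpha>) * v" for \<alpha>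
  proof (cases \<alpha>)
    case Inf
    have "ratfun_recip (uniformizer Inf) = ratfun_z"
      using ratfun_recip_z ratfun_recip_recip[of ratfun_z] by simp
    thus ?thesis
      unfolding Inf by (intro exI[of _ 1]) (simp add: unit_at_def ratfun_z_def del: regular_at.simps)
  next
    case (Fin a)
    show ?thesis
    proof (cases "a = 0")
      case True
      thus ?thesis
        unfolding Fin True uniformizer_0 ratfun_recip_z
        by (intro exI[of _ 1]) (simp add: unit_at_def del: regular_at.simps)
    next
      case False
      have lin: "to_fract [:b, 1:] = const_ratfun b + ratfun_z" for b
        by (simp add: const_ratfun_def ratfun_z_def flip: to_fract_add)
      \<comment> \<open>\<open>1/z - a = (z - 1/a) (- a/z)\<close>\<close>
      define v where "v = const_ratfun (- a) / ratfun_z"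
      have v: "v = Fraction_Field.Fract [:- a:] [:0, 1:]"
        by (simp add: v_def const_ratfun_def ratfun_z_def Fract_conv_to_fract)
      have "const_ratfun (- a) * const_ratfun (- (1 / a)) = 1"
        using False by (simp flip: const_ratfun.hom_mult)
      hence "ratfun_recip (uniformizer (Fin a)) = uniformizer (Fin (1 / a)) * v"
        using ratfun_z_nonzero
        by (simp add: lin ratfun_recip.hom_add ratfun_recip_z v_def field_simps del: regular_at.simps)
      moreover have "unit_at (Fin (1 / a)) v"
        unfolding unit_at_def v using False
        by (auto intro!: regular_at_FinI simp: Fract_conv_to_fract simp del: regular_at.simps)
           (auto intro!: regular_at_FinI simp: Fract_conv_to_fract[symmetric] simp del: regular_at.simps)
      ultimately show ?thesis
        using False unfolding Fin by auto
    qed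
  qed
  have imp: "has_order (einverse \<alpha>) (ratfun_recip f) k" if f: "has_order \<alpha> f k" for \<alpha> f
  proof -
    obtain u where u: "unit_at \<alpha> u" "f = uniformizer \<alpha> ^ k * u"
      using f by (rule has_orderE)
    obtain v where v: "unit_at (einverse \<alpha>) v"
      "ratfun_recip (uniformizer \<alpha>) = uniformizer (einverse \<alpha>) * v"
      using * by blast
    have "ratfun_recip f = uniformizer (einverse \<alpha>) ^ k * (v ^ k * ratfun_recip u)"
      by (simp add: u(2) ratfun_recip.hom_mult ratfun_recip.hom_power v(2) power_mult_distrib)
    moreover have "unit_at (einverse \<alpha>) (v ^ k * ratfun_recip u)"
      using u(1) v(1) by (intro unit_at_mult unit_at_power) (auto simp: unit_at_ratfun_recip)
    ultimately show ?thesis unfolding has_order_def by blast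
  qed
  show ?thesis
    using imp[of \<alpha> "ratfun_recip f"] imp[of "einverse \<alpha>" f] by auto
qed

lemma has_order_to_fract:
  assumes "p \<noteq> 0"
  shows "has_order (Fin a) (to_fract p) (Polynomial.order a p)"
proof -
  obtain q where q: "p = [:- a, 1:] ^ Polynomial.order a p * q" "\<not> [:- a, 1:] dvd q"
    using order_decomp[OF assms] by blast
  have "poly q a \<noteq> 0" using q(2) by (simp add: poly_eq_0_iff_dvd)
  hence "unit_at (Fin a) (to_fract q)"
    using regular_at_FinI[of q a 1]
    by (auto simp: unit_at_def Fract_conv_to_fract inverse_eq_divide simp del: regular_at.simps(1))
  moreover have "to_fract p = uniformizer (Fin a) ^ Polynomial.order a p * to_fract q"
    using q(1) by (metis to_fract_mult to_fract_power uniformizer.simps(1))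
  ultimately show ?thesis unfolding has_order_def by blast
qed

lemma regular_has_order:
  assumes "regular_at \<alpha> f" "f \<noteq> 0"
  shows "\<exists>k. has_order \<alpha> f k"
proof -
  have *: "\<exists>k. has_order (Fin a) f k" if f: "regular_at (Fin a) f" "f \<noteq> 0" for a f
  proof -
    obtain p q where q: "poly q a \<noteq> 0" "q \<noteq> 0" and f': "f = Fraction_Field.Fract p q"
      using f(1) by (rule regular_at_FinE)
    have "p \<noteq> 0" using f' f(2) by (auto simp: fract_collapse)
    have "unit_at (Fin a) (to_fract q)"
      using q regular_at_FinI[of q a 1]
      by (auto simp: unit_at_def Fract_conv_to_fract inverse_eq_divide simp del: regular_at.simps(1))
    hence "has_order (Fin a) (inverse (to_fract q)) 0"
      by (simp add: has_order_0_iff unit_at_inverse)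
    from has_order_mult[OF has_order_to_fract[OF \<open>p \<noteq> 0\<close>] this] show ?thesis
      by (auto simp: f' Fract_conv_to_fract divide_inverse)
  qed
  show ?thesis
  proof (cases \<alpha>)
    case Inf
    have "\<exists>k. has_order (Fin 0) (ratfun_recip f) k"
      using assms * unfolding Inf regular_at_Inf by simp
    thus ?thesis
      by (simp add: Inf has_order_ratfun_recip)
  qed (use assms * in blast)
qed


section \<open>Matrices over the local ring\<close>

text \<open>Matrices with entries in the local ring.\<close>

definition regular_mat_at :: "ecomplex \<Rightarrow> ratmat \<Rightarrow> bool" where
  "regular_mat_at \<alpha> G \<longleftrightarrow> (\<forall>i<dim_row G. \<forall>j<dim_col G. regular_at \<alpha> (G $$ (i, j)))"

lemma regular_mat_at_of_analytic:
  "ratmat_analytic_on G A \<Longrightarrow> \<alpha> \<in> A \<Longrightarrow> regular_mat_at \<alpha> G"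
  by (auto simp: ratmat_analytic_on_def regular_mat_at_def intro: regular_at_of_analytic)

lemma regular_mat_at_mult:
  assumes "regular_mat_at \<alpha> G" "regular_mat_at \<alpha> H" "dim_col G = dim_row H"
  shows "regular_mat_at \<alpha> (G * H)"
  using assms unfolding regular_mat_at_def
  by (auto simp: times_mat_def scalar_prod_def intro!: regular_at_sum regular_at_mult)

lemma regular_mat_at_add:
  assumes "regular_mat_at \<alpha> G" "regular_mat_at \<alpha> H" "dim_row G = dim_row H" "dim_col G = dim_col H"
  shows "regular_mat_at \<alpha> (G + H)"
  using assms unfolding regular_mat_at_def by (auto intro!: regular_at_add)

lemma regular_mat_at_transpose: "regular_mat_at \<alpha> G\<^sup>T \<longleftrightarrow> regular_mat_at \<alpha> G"
  by (auto simp: regular_mat_at_def)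

lemma regular_mat_at_one: "regular_mat_at \<alpha> (1\<^sub>m n)"
  by (auto simp: regular_mat_at_def)

lemma regular_mat_at_zero: "regular_mat_at \<alpha> (0\<^sub>m m n)"
  by (auto simp: regular_mat_at_def)

lemma regular_mat_at_to_fract: "regular_mat_at (Fin a) (map_mat to_fract M)"
  by (auto simp: regular_mat_at_def)

lemma regular_at_det:
  assumes "regular_mat_at \<alpha> G" "G \<in> carrier_mat n n"
  shows "regular_at \<alpha> (Determinant.det G)"
proof -
  have s: "regular_at \<alpha> (signof p)" for p
    by (simp add: sign_def regular_at_uminus)
  show ?thesis
    using assms unfolding Determinant.det_def'[OF assms(2)] regular_mat_at_def
    by (intro regular_at_sum regular_at_mult s regular_at_prod) (auto simp: permutes_def)
qed

lemma regular_mat_at_adj: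
  assumes "regular_mat_at \<alpha> G" "G \<in> carrier_mat n n"
  shows "regular_mat_at \<alpha> (adj_mat G)"
  unfolding regular_mat_at_def
proof (intro allI impI)
  fix i j assume "i < dim_row (adj_mat G)" "j < dim_col (adj_mat G)"
  hence ij: "i < n" "j < n" using adj_mat(1)[OF assms(2)] by auto
  have "regular_mat_at \<alpha> (mat_delete G j i)"
    using assms by (auto simp: regular_mat_at_def mat_delete_def)
  moreover have "mat_delete G j i \<in> carrier_mat (n - 1) (n - 1)"
    using assms(2) by (rule mat_delete_carrier)
  ultimately have "regular_at \<alpha> (Determinant.det (mat_delete G j i))"
    by (rule regular_at_det)
  thus "regular_at \<alpha> (adj_mat G $$ (i, j))"
    using ij assms(2) by (auto simp: adj_mat_def cofactor_def
        intro!: regular_at_mult regular_at_power regular_at_uminus)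
qed

text \<open>Cramer's rule over the local ring.\<close>

lemma regular_mat_at_inverse:
  assumes "regular_mat_at \<alpha> E" "E \<in> carrier_mat n n" "unit_at \<alpha> (Determinant.det E)"
  obtains F where "F \<in> carrier_mat n n" "regular_mat_at \<alpha> F" "F * E = 1\<^sub>m n"
proof
  define F where "F = inverse (Determinant.det E) \<cdot>\<^sub>m adj_mat E"
  show F: "F \<in> carrier_mat n n" using adj_mat(1)[OF assms(2)] by (simp add: F_def)
  have "dim_row (adj_mat E) = n" "dim_col (adj_mat E) = n"
    using adj_mat(1)[OF assms(2)] by auto
  thus "regular_mat_at \<alpha> F"
    using regular_mat_at_adj[OF assms(1,2)] assms(3)
    by (auto simp: F_def regular_mat_at_def unit_at_def intro!: regular_at_mult)
  have "F * E = inverse (Determinant.det E) \<cdot>\<^sub>m (adj_mat E * E)"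
    unfolding F_def by (rule mult_smult_assoc_mat[OF adj_mat(1)[OF assms(2)] assms(2)])
  also have "\<dots> = 1\<^sub>m n"
    using assms(3) by (auto simp: adj_mat(3)[OF assms(2)] unit_at_def)
  finally show "F * E = 1\<^sub>m n" .
qed

text \<open>The change of variable acts on matrices.\<close>

lemma ratmat_recip_carrier [simp]: "ratmat_recip G \<in> carrier_mat m n \<longleftrightarrow> G \<in> carrier_mat m n"
  by (auto simp: ratmat_recip_def)

lemma ratmat_recip_dim [simp]:
  "dim_row (ratmat_recip G) = dim_row G" "dim_col (ratmat_recip G) = dim_col G"
  by (auto simp: ratmat_recip_def)

lemma ratmat_recip_recip [simp]: "ratmat_recip (ratmat_recip G) = G"
  by (rule eq_matI) (auto simp: ratmat_recip_def)

lemma ratmat_recip_mult: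
  assumes "G \<in> carrier_mat m k" "H \<in> carrier_mat k n"
  shows "ratmat_recip (G * H) = ratmat_recip G * ratmat_recip H"
  unfolding ratmat_recip_def by (rule ratfun_recip.mat_hom_mult[OF assms])

lemma ratmat_recip_add:
  assumes "G \<in> carrier_mat m n" "H \<in> carrier_mat m n"
  shows "ratmat_recip (G + H) = ratmat_recip G + ratmat_recip H"
  using assms by (intro eq_matI) (auto simp: ratmat_recip_def ratfun_recip.hom_add)

lemma ratmat_recip_one [simp]: "ratmat_recip (1\<^sub>m n) = 1\<^sub>m n"
  unfolding ratmat_recip_def by (rule ratfun_recip.mat_hom_one)

lemma ratmat_recip_transpose: "ratmat_recip G\<^sup>T = (ratmat_recip G)\<^sup>T"
  by (rule eq_matI) (auto simp: ratmat_recip_def)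

lemma det_ratmat_recip: "Determinant.det (ratmat_recip G) = ratfun_recip (Determinant.det G)"
  unfolding ratmat_recip_def by (rule ratfun_recip.hom_det)

lemma regular_mat_at_ratmat_recip:
  "regular_mat_at \<alpha> (ratmat_recip G) \<longleftrightarrow> regular_mat_at (einverse \<alpha>) G"
  by (auto simp: regular_mat_at_def ratmat_recip_def regular_at_ratfun_recip)


section \<open>Left denominators\<close>

text \<open>
  \<open>D\<close> is the denominator of a left coprime factorization \<open>X = D\<^sup>-\<^sup>1 N\<close> over the local ring; the last
  conjunct is the Bezout identity that expresses coprimality of \<open>N = D X\<close> and \<open>D\<close>.
\<close>

definition left_denominator :: "ecomplex \<Rightarrow> ratmat \<Rightarrow> ratmat \<Rightarrow> bool" where
  "left_denominator \<alpha> X D \<longleftrightarrow>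
     D \<in> carrier_mat (dim_row X) (dim_row X) \<and> Determinant.det D \<noteq> 0 \<and>
     regular_mat_at \<alpha> D \<and> regular_mat_at \<alpha> (D * X) \<and>
     (\<exists>A \<in> carrier_mat (dim_col X) (dim_row X). \<exists>B \<in> carrier_mat (dim_row X) (dim_row X).
        regular_mat_at \<alpha> A \<and> regular_mat_at \<alpha> B \<and> D * X * A + D * B = 1\<^sub>m (dim_row X))"

lemma left_denominator_ratmat_recip_imp:
  assumes "left_denominator \<alpha> X D"
  shows "left_denominator (einverse \<alpha>) (ratmat_recip X) (ratmat_recip D)"
proof -
  define m n where "m = dim_row X" and "n = dim_col X"
  have X: "X \<in> carrier_mat m n" by (auto simp: m_def n_def)
  obtain A B where D: "D \<in> carrier_mat m m" "Determinant.det D \<noteq> 0" "regular_mat_at \<alpha> D"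
      "regular_mat_at \<alpha> (D * X)"
    and A: "A \<in> carrier_mat n m" "regular_mat_at \<alpha> A"
    and B: "B \<in> carrier_mat m m" "regular_mat_at \<alpha> B"
    and eq: "D * X * A + D * B = 1\<^sub>m m"
    using assms unfolding left_denominator_def m_def n_def by blast
  have DX: "D * X \<in> carrier_mat m n" and DXA: "D * X * A \<in> carrier_mat m m"
    and DB: "D * B \<in> carrier_mat m m"
    using D X A B by auto
  have "ratmat_recip (D * X * A + D * B) = 1\<^sub>m m"
    unfolding eq by simp
  hence "ratmat_recip D * ratmat_recip X * ratmat_recip A + ratmat_recip D * ratmat_recip B = 1\<^sub>m m"
    by (simp only: ratmat_recip_add[OF DXA DB] ratmat_recip_mult[OF DX A(1)]
        ratmat_recip_mult[OF D(1) X] ratmat_recip_mult[OF D(1) B(1)])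
  moreover have "regular_mat_at (einverse \<alpha>) (ratmat_recip D * ratmat_recip X)"
    using D(4) by (simp add: regular_mat_at_ratmat_recip flip: ratmat_recip_mult[OF D(1) X])
  ultimately show ?thesis
    unfolding left_denominator_def ratmat_recip_dim m_def[symmetric] n_def[symmetric]
    using D A B by (intro conjI bexI[of _ "ratmat_recip A"] bexI[of _ "ratmat_recip B"])
      (auto simp: regular_mat_at_ratmat_recip det_ratmat_recip)
qed

text \<open>
  Over the local ring \<open>O\<close>, a left denominator \<open>D\<close> of \<open>X\<close> describes the lattice
  \<open>X O\<^sup>n + O\<^sup>m = D\<^sup>-\<^sup>1 O\<^sup>m\<close>. Multiplying \<open>X\<close> from the right by a regular matrix shrinks the lattice.
\<close>

lemma left_denominator_factor:
  assumes M: "M \<in> carrier_mat m k" and W: "W \<in> carrier_mat k n" "regular_mat_at \<alpha> W"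
    and D: "left_denominator \<alpha> M D" and D': "left_denominator \<alpha> (M * W) D'"
  obtains E where "E \<in> carrier_mat m m" "regular_mat_at \<alpha> E" "D = E * D'"
proof -
  have dM: "dim_row M = m" "dim_row (M * W) = m" "dim_col (M * W) = n" using M W by auto
  have D1: "D \<in> carrier_mat m m" "regular_mat_at \<alpha> D" "regular_mat_at \<alpha> (D * M)"
    using D unfolding left_denominator_def dM by auto
  obtain A B where D'1: "D' \<in> carrier_mat m m" "Determinant.det D' \<noteq> 0"
    and A: "A \<in> carrier_mat n m" "regular_mat_at \<alpha> A"
    and B: "B \<in> carrier_mat m m" "regular_mat_at \<alpha> B"
    and eq: "D' * (M * W) * A + D' * B = 1\<^sub>m m"
    using D' unfolding left_denominator_def dM by blast
  define P where "P = M * W * A + B"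
  have P: "P \<in> carrier_mat m m" using M W A B by (auto simp: P_def)
  have "D' * P = 1\<^sub>m m"
    unfolding eq[symmetric] P_def using D'1(1) M W A B
    by (simp add: mult_add_distrib_mat[of _ m m _ m] assoc_mult_mat[of _ m m _ n _ m])
  hence PD': "P * D' = 1\<^sub>m m"
    using mat_mult_left_right_inverse[OF D'1(1) P] by simp
  show thesis
  proof
    define E where "E = D * P"
    show "E \<in> carrier_mat m m" using D1 P by (simp add: E_def)
    have "E = (D * M) * W * A + D * B"
      unfolding E_def P_def using D1(1) M W A B
      by (simp add: mult_add_distrib_mat[of _ m m _ m] assoc_mult_mat[of _ m m _ n _ m]
          assoc_mult_mat[of _ m m _ k _ n])
    moreover have "regular_mat_at \<alpha> (D * M * W * A + D * B)"
      using D1 M W A B by (intro regular_mat_at_add regular_mat_at_mult[of _ "D * M * W"]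
          regular_mat_at_mult[of _ "D * M"] regular_mat_at_mult[of _ D B]) auto
    ultimately show "regular_mat_at \<alpha> E" by simp
    have "E * D' = D * (P * D')"
      unfolding E_def by (rule assoc_mult_mat[OF D1(1) P D'1(1)])
    thus "D = E * D'" using PD' D1(1) by simp
  qed
qed

lemma left_denominator_order_unique:
  assumes "left_denominator \<alpha> X D" "left_denominator \<alpha> X D'"
    and "has_order \<alpha> (Determinant.det D) k" "has_order \<alpha> (Determinant.det D') l"
  shows "k = l"
proof -
  have *: "l \<le> k" if DX: "left_denominator \<alpha> X D" and D'X: "left_denominator \<alpha> X D'"
      and Dk: "has_order \<alpha> (Determinant.det D) k" and D'l: "has_order \<alpha> (Determinant.det D') l" for D D' k l
  proof -
    define m n where "m = dim_row X" and "n = dim_col X"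
    have X: "X \<in> carrier_mat m n" by (auto simp: m_def n_def)
    have "left_denominator \<alpha> (X * 1\<^sub>m n) D'" using D'X X by simp
    note * = left_denominator_factor[OF X one_carrier_mat regular_mat_at_one DX this]
    obtain E where E: "E \<in> carrier_mat m m" "regular_mat_at \<alpha> E" "D = E * D'"
      by (rule *)
    have D': "D' \<in> carrier_mat m m" using D'X by (simp add: left_denominator_def m_def)
    have det: "Determinant.det D = Determinant.det E * Determinant.det D'"
      unfolding E(3) by (rule det_mult[OF E(1) D'])
    moreover have "Determinant.det D \<noteq> 0" using DX by (simp add: left_denominator_def)
    ultimately have "Determinant.det E \<noteq> 0" by auto
    then obtain j where "has_order \<alpha> (Determinant.det E) j"
      using regular_has_order regular_at_det[OF E(2,1)] by blast
    from has_order_mult[OF this D'l] have "k = j + l"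
      using has_order_unique Dk unfolding det by blast
    thus ?thesis by simp
  qed
  show ?thesis
    using *[OF assms(1,2,3,4)] *[OF assms(2,1,4,3)] by simp
qed

text \<open>
  If the lattice does not shrink, i.e. if the orders of the determinants agree, then \<open>M\<close> is
  recovered from \<open>M W\<close> modulo regular matrices.
\<close>

lemma left_denominator_mult:
  assumes M: "M \<in> carrier_mat m k" and W: "W \<in> carrier_mat k n" "regular_mat_at \<alpha> W"
    and D: "left_denominator \<alpha> M D" "has_order \<alpha> (Determinant.det D) d"
    and D': "left_denominator \<alpha> (M * W) D'" "has_order \<alpha> (Determinant.det D') d'"
  shows "d' \<le> d"
    and "d = d' \<Longrightarrow> \<exists>Y \<in> carrier_mat n k. \<exists>Z \<in> carrier_mat m k.
      regular_mat_at \<alpha> Y \<and> regular_mat_at \<alpha> Z \<and> M = M * W * Y + Z"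
proof -
  obtain E where E: "E \<in> carrier_mat m m" "regular_mat_at \<alpha> E" "D = E * D'"
    using left_denominator_factor[OF M W D(1) D'(1)] by blast
  have dM: "dim_row M = m" "dim_col M = k" "dim_row (M * W) = m" "dim_col (M * W) = n"
    using M W by auto
  have D1: "D \<in> carrier_mat m m" "Determinant.det D \<noteq> 0" "regular_mat_at \<alpha> (D * M)"
    using D(1) unfolding left_denominator_def dM by auto
  obtain A B where D'1: "D' \<in> carrier_mat m m" "Determinant.det D' \<noteq> 0"
    and A: "A \<in> carrier_mat n m" "regular_mat_at \<alpha> A"
    and B: "B \<in> carrier_mat m m" "regular_mat_at \<alpha> B"
    and eq: "D' * (M * W) * A + D' * B = 1\<^sub>m m"
    using D'(1) unfolding left_denominator_def dM by blast
  have det: "Determinant.det D = Determinant.det E * Determinant.det D'"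
    unfolding E(3) by (rule det_mult[OF E(1) D'1(1)])
  have "Determinant.det E \<noteq> 0" using det D1(2) by auto
  then obtain j where j: "has_order \<alpha> (Determinant.det E) j"
    using regular_has_order regular_at_det[OF E(2,1)] by blast
  from has_order_mult[OF this D'(2)] have d: "d = j + d'"
    using has_order_unique D(2) unfolding det by blast
  thus "d' \<le> d" by simp
  assume "d = d'"
  hence "unit_at \<alpha> (Determinant.det E)"
    using d j by (simp add: has_order_0_iff)
  then obtain F where F: "F \<in> carrier_mat m m" "regular_mat_at \<alpha> F" "F * E = 1\<^sub>m m"
    using regular_mat_at_inverse[OF E(2,1)] by blast
  have DM: "D * M \<in> carrier_mat m k" "D' * M \<in> carrier_mat m k" using D1(1) D'1(1) M by auto
  have "D' * M = F * E * (D' * M)" unfolding F(3) using left_mult_one_mat[OF DM(2)] by simp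
  also have "\<dots> = F * (D * M)"
    unfolding E(3) assoc_mult_mat[OF F(1) E(1) DM(2)] assoc_mult_mat[OF E(1) D'1(1) M] ..
  finally have D'M: "regular_mat_at \<alpha> (D' * M)"
    using F D1 DM by (auto intro!: regular_mat_at_mult)
  define P where "P = M * W * A + B"
  have MWA: "M * W * A \<in> carrier_mat m m" using M W A by auto
  have P: "P \<in> carrier_mat m m" using MWA B by (auto simp: P_def)
  have "D' * P = 1\<^sub>m m"
    unfolding eq[symmetric] P_def using D'1(1) M W A B
    by (simp add: mult_add_distrib_mat[of _ m m _ m] assoc_mult_mat[of _ m m _ n _ m])
  hence PD': "P * D' = 1\<^sub>m m"
    using mat_mult_left_right_inverse[OF D'1(1) P] by simp
  have "M = P * D' * M" using PD' M by simp
  also have "\<dots> = P * (D' * M)" by (rule assoc_mult_mat[OF P D'1(1) M])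
  also have "\<dots> = M * W * (A * (D' * M)) + B * (D' * M)"
    unfolding P_def using add_mult_distrib_mat[OF MWA B(1) DM(2)]
      assoc_mult_mat[OF _ A(1) DM(2), of "M * W" m] M W by simp
  finally have "M = M * W * (A * (D' * M)) + B * (D' * M)" .
  moreover have "regular_mat_at \<alpha> (A * (D' * M))" "regular_mat_at \<alpha> (B * (D' * M))"
    using A B DM D'M by (auto intro!: regular_mat_at_mult)
  ultimately show "\<exists>Y \<in> carrier_mat n k. \<exists>Z \<in> carrier_mat m k.
      regular_mat_at \<alpha> Y \<and> regular_mat_at \<alpha> Z \<and> M = M * W * Y + Z"
    using A B DM by (intro bexI[of _ "A * (D' * M)"] bexI[of _ "B * (D' * M)"]) auto
qed


section \<open>Smith form\<close>

text \<open>
  A rank-one step. Among the nonzero values \<open>x\<^sup>T A y\<close> with polynomial vectors \<open>x, y\<close> take one,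
  \<open>g\<close>, of minimal degree. For fixed \<open>x\<close> the values form an ideal, so \<open>g\<close> divides the row \<open>x\<^sup>T A\<close>;
  likewise it divides the column \<open>A y\<close>, and by a further use of minimality the whole of \<open>A\<close>.
\<close>

lemma smith_step:
  fixes A :: "nat \<Rightarrow> nat \<Rightarrow> complex poly"
  assumes nz: "i0 < m" "j0 < n" "A i0 j0 \<noteq> 0"
  obtains g x y c f where
    "lead_coeff g = 1"
    "\<And>i. i < m \<Longrightarrow> (\<Sum>j<n. A i j * y j) = g * c i"
    "\<And>j. j < n \<Longrightarrow> (\<Sum>i<m. x i * A i j) = g * f j"
    "(\<Sum>i<m. x i * c i) = 1"
    "(\<Sum>j<n. f j * y j) = 1"
    "\<And>i j. i < m \<Longrightarrow> j < n \<Longrightarrow> g dvd A i j"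
proof -
  \<comment> \<open>The bilinear form \<open>x\<^sup>T A y\<close>; the unit vectors \<open>e i\<close> recover the entries of \<open>A\<close>.\<close>
  define \<beta> where "\<beta> x y = (\<Sum>i<m. \<Sum>j<n. x i * A i j * y j)" for x y
  have add1: "\<beta> (\<lambda>i. x i + x' i) y = \<beta> x y + \<beta> x' y" for x x' y
    by (simp add: \<beta>_def ring_distribs sum.distrib)
  have add2: "\<beta> x (\<lambda>i. y i + y' i) = \<beta> x y + \<beta> x y'" for x y y'
    by (simp add: \<beta>_def ring_distribs sum.distrib)
  have sc1: "\<beta> (\<lambda>i. a * x i) y = a * \<beta> x y" for x y a
    by (simp add: \<beta>_def sum_distrib_left mult_ac)
  have sc2: "\<beta> x (\<lambda>i. a * y i) = a * \<beta> x y" for x y a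
    by (simp add: \<beta>_def sum_distrib_left mult_ac)
  define e where "e i = (\<lambda>k. if k = i then 1 else (0 :: complex poly))" for i :: nat
  have b1: "\<beta> x (e j) = (\<Sum>i<m. x i * A i j)" if "j < n" for x j
    using that by (simp add: \<beta>_def e_def if_distrib sum.delta cong: if_cong)
  have b2: "\<beta> (e i) y = (\<Sum>j<n. A i j * y j)" if "i < m" for y i
  proof -
    have "\<beta> (e i) y = (\<Sum>k<m. if k = i then \<Sum>j<n. A k j * y j else 0)"
      unfolding \<beta>_def by (rule sum.cong) (auto simp: e_def)
    thus ?thesis using that by simp
  qed
  have b12: "\<beta> (e i) (e j) = A i j" if "i < m" "j < n" for i j
    using b1[OF that(2), of "e i"] that(1) by (simp add: e_def if_distrib[of "\<lambda>t. t * _"] cong: if_cong)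
  define P where "P d \<longleftrightarrow> (\<exists>x y. \<beta> x y \<noteq> 0 \<and> degree (\<beta> x y) = d)" for d
  have "P (degree (A i0 j0))"
    unfolding P_def using b12[OF nz(1,2)] nz(3) by metis
  then obtain d where d: "P d" "\<And>k. k < d \<Longrightarrow> \<not> P k"
    using exists_least_iff[of P] by blast
  obtain x1 y where xy: "\<beta> x1 y \<noteq> 0" "degree (\<beta> x1 y) = d" using d(1) unfolding P_def by blast
  define a where "a = [:1 / lead_coeff (\<beta> x1 y):]"
  define x where "x = (\<lambda>i. a * x1 i)"
  define g where "g = \<beta> x y"
  have g': "g = Polynomial.smult (1 / lead_coeff (\<beta> x1 y)) (\<beta> x1 y)"
    unfolding g_def x_def sc1 by (simp add: a_def)
  have lead: "lead_coeff g = 1" and degg: "degree g = d" and g0: "g \<noteq> 0"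
    using xy by (auto simp: g')
  \<comment> \<open>If \<open>h\<close> is a value up to any multiple of \<open>g\<close>, then so is its remainder modulo \<open>g\<close>.\<close>
  have min: "g dvd h" if h: "\<And>q. \<exists>x y. \<beta> x y = h - q * g" for h
  proof -
    obtain x' y' where "\<beta> x' y' = h - (h div g) * g" using h by blast
    hence *: "\<beta> x' y' = h mod g" by (simp add: minus_div_mult_eq_mod)
    have "h mod g = 0"
    proof (rule ccontr)
      assume nz: "h mod g \<noteq> 0"
      hence "degree (h mod g) < d"
        using degree_mod_less[OF g0, of h] degg by auto
      moreover have "P (degree (h mod g))"
        unfolding P_def using * nz by metis
      ultimately show False using d(2) by blast
    qed
    thus ?thesis by (simp add: mod_eq_0_iff_dvd)
  qed
  have dvd_row: "g dvd \<beta> x y'" for y'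
  proof (rule min)
    fix q
    have "\<beta> x (\<lambda>j. y' j + - q * y j) = \<beta> x y' - q * g"
      by (simp only: add2 sc2 g_def) simp
    thus "\<exists>x' y''. \<beta> x' y'' = \<beta> x y' - q * g" by blast
  qed
  have dvd_col: "g dvd \<beta> x' y" for x'
  proof (rule min)
    fix q
    have "\<beta> (\<lambda>j. x' j + - q * x j) y = \<beta> x' y - q * g"
      by (simp only: add1 sc1 g_def) simp
    thus "\<exists>x'' y''. \<beta> x'' y'' = \<beta> x' y - q * g" by blast
  qed
  define c where "c i = \<beta> (e i) y div g" for i
  define f where "f j = \<beta> x (e j) div g" for j
  have c: "g * c i = \<beta> (e i) y" for i
    using dvd_col by (simp add: c_def)
  have f: "g * f i = \<beta> x (e i)" for i
    using dvd_row by (simp add: f_def)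
  have "g * (\<Sum>i<m. x i * c i) = (\<Sum>i<m. x i * (g * c i))"
    by (simp add: sum_distrib_left mult_ac)
  also have "\<dots> = (\<Sum>i<m. x i * (\<Sum>j<n. A i j * y j))"
    by (intro sum.cong) (auto simp: c b2)
  also have "\<dots> = g" by (simp add: g_def \<beta>_def sum_distrib_left mult_ac)
  finally have xc: "(\<Sum>i<m. x i * c i) = 1" using g0 by simp
  have "g * (\<Sum>j<n. f j * y j) = (\<Sum>j<n. (g * f j) * y j)"
    by (simp add: sum_distrib_left mult_ac)
  also have "\<dots> = (\<Sum>j<n. (\<Sum>i<m. x i * A i j) * y j)"
    by (intro sum.cong) (auto simp: f b1)
  also have "\<dots> = g" unfolding g_def \<beta>_def by (subst sum.swap) (simp add: sum_distrib_right)
  finally have fy: "(\<Sum>j<n. f j * y j) = 1" using g0 by simp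
  have dvd_A: "g dvd \<beta> u v" for u v
  proof -
    \<comment> \<open>Adding multiples of \<open>x\<close> to \<open>u\<close> and of \<open>y\<close> to \<open>v\<close> makes \<open>\<beta> u y\<close> and \<open>\<beta> x v\<close> vanish and
      changes \<open>\<beta> u v\<close> by a multiple of \<open>g\<close> only.\<close>
    define s t where "s = - (\<beta> u y div g)" and "t = - (\<beta> x v div g)"
    have st: "\<beta> u y = - s * g" "\<beta> x v = - t * g"
      using dvd_col dvd_row by (simp_all add: s_def t_def)
    define u' v' where "u' = (\<lambda>i. u i + s * x i)" and "v' = (\<lambda>j. v j + t * y j)"
    have o: "\<beta> u' y = 0" "\<beta> x v' = 0"
      by (simp_all only: u'_def v'_def add1 add2 sc1 sc2 st g_def[symmetric]) simp_all
    have "g dvd \<beta> u' v'"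
    proof (rule min)
      fix q
      have "\<beta> (\<lambda>i. u' i + x i) (\<lambda>j. v' j + - q * y j) = \<beta> u' v' - q * g"
        by (simp only: add1 add2 sc1 sc2 o g_def[symmetric]) simp
      thus "\<exists>x'' y''. \<beta> x'' y'' = \<beta> u' v' - q * g" by blast
    qed
    moreover have "\<beta> u' v' = \<beta> u v + - (s * t) * g"
      by (simp only: u'_def v'_def add1 add2 sc1 sc2 st g_def[symmetric]) (simp add: algebra_simps)
    ultimately show ?thesis
      by (metis dvd_add_times_triv_right_iff mult.commute)
  qed
  show thesis
  proof (rule that[OF lead _ _ xc fy])
    show "(\<Sum>j<n. A i j * y j) = g * c i" if "i < m" for i using that by (simp add: c b2)
    show "(\<Sum>i<m. x i * A i j) = g * f j" if "j < n" for j using that by (simp add: f b1)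
    show "g dvd A i j" if "i < m" "j < n" for i j using dvd_A[of "e i" "e j"] that by (simp add: b12)
  qed
qed

text \<open>
  The state after \<open>k\<close> steps: \<open>A = C diag(d) F + B\<close>, where \<open>L\<close> and \<open>R\<close> are one-sided inverses of
  \<open>C\<close> and \<open>F\<close> that annihilate the remainder \<open>B\<close>. Matrices are functions of two indices here.
\<close>

definition smith_state ::
  "nat \<Rightarrow> nat \<Rightarrow> (nat \<Rightarrow> nat \<Rightarrow> complex poly) \<Rightarrow> nat \<Rightarrow> (nat \<Rightarrow> complex poly) \<Rightarrow>
   (nat \<Rightarrow> nat \<Rightarrow> complex poly) \<Rightarrow> (nat \<Rightarrow> nat \<Rightarrow> complex poly) \<Rightarrow>
   (nat \<Rightarrow> nat \<Rightarrow> complex poly) \<Rightarrow> (nat \<Rightarrow> nat \<Rightarrow> complex poly) \<Rightarrow>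
   (nat \<Rightarrow> nat \<Rightarrow> complex poly) \<Rightarrow> bool" where
  "smith_state m n A k d C F L R B \<longleftrightarrow>
     (\<forall>s<k. \<forall>t<k. (\<Sum>i<m. L s i * C i t) = (if s = t then 1 else 0)) \<and>
     (\<forall>s<k. \<forall>t<k. (\<Sum>j<n. F s j * R j t) = (if s = t then 1 else 0)) \<and>
     (\<forall>s<k. \<forall>j<n. (\<Sum>i<m. L s i * B i j) = 0) \<and>
     (\<forall>i<m. \<forall>t<k. (\<Sum>j<n. B i j * R j t) = 0) \<and>
     (\<forall>i<m. \<forall>j<n. A i j = (\<Sum>s<k. C i s * d s * F s j) + B i j) \<and>
     (\<forall>s<k. lead_coeff (d s) = 1) \<and> (\<forall>s. Suc s < k \<longrightarrow> d s dvd d (Suc s)) \<and>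
     (\<forall>i<m. \<forall>j<n. 0 < k \<longrightarrow> d (k - 1) dvd B i j)"

text \<open>A row vector can be made orthogonal to \<open>C\<close> without changing its product with \<open>B\<close>.\<close>

lemma orthogonalize:
  fixes L C B :: "nat \<Rightarrow> nat \<Rightarrow> 'a :: comm_ring_1" and x :: "nat \<Rightarrow> 'a"
  assumes LC: "\<forall>s<k. \<forall>t<k. (\<Sum>i<m. L s i * C i t) = (if s = t then 1 else 0)"
    and LB: "\<forall>s<k. \<forall>j<n. (\<Sum>i<m. L s i * B i j) = 0"
  obtains x' where "\<And>t. t < k \<Longrightarrow> (\<Sum>i<m. x' i * C i t) = 0"
    and "\<And>j. j < n \<Longrightarrow> (\<Sum>i<m. x' i * B i j) = (\<Sum>i<m. x i * B i j)"
proof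
  define a where "a s = (\<Sum>i<m. x i * C i s)" for s
  define x' where "x' i = x i - (\<Sum>s<k. a s * L s i)" for i
  have x': "(\<Sum>i<m. x' i * M i) = (\<Sum>i<m. x i * M i) - (\<Sum>s<k. a s * (\<Sum>i<m. L s i * M i))" for M
  proof -
    have "(\<Sum>i<m. x' i * M i) = (\<Sum>i<m. x i * M i) - (\<Sum>i<m. \<Sum>s<k. a s * (L s i * M i))"
      by (simp add: x'_def left_diff_distrib sum_subtractf sum_distrib_right mult.assoc)
    also have "(\<Sum>i<m. \<Sum>s<k. a s * (L s i * M i)) = (\<Sum>s<k. a s * (\<Sum>i<m. L s i * M i))"
      by (subst sum.swap) (simp add: sum_distrib_left)
    finally show ?thesis .
  qed
  show "(\<Sum>i<m. x' i * C i t) = 0" if "t < k" for t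
  proof -
    have "(\<Sum>s<k. a s * (\<Sum>i<m. L s i * C i t)) = (\<Sum>s<k. if s = t then a s else 0)"
      using LC that by (intro sum.cong) auto
    thus ?thesis using that by (simp add: x' a_def)
  qed
  show "(\<Sum>i<m. x' i * B i j) = (\<Sum>i<m. x i * B i j)" if "j < n" for j
    using LB that by (simp add: x')
qed

lemma smith_state_step:
  assumes st: "smith_state m n A k d C F L R B" and nz: "i0 < m" "j0 < n" "B i0 j0 \<noteq> 0"
  shows "\<exists>d' C' F' L' R' B'. smith_state m n A (Suc k) d' C' F' L' R' B'"
proof -
  note st' = st[unfolded smith_state_def]
  obtain g x0 y0 c f where g: "lead_coeff g = 1"
    and By0: "\<And>i. i < m \<Longrightarrow> (\<Sum>j<n. B i j * y0 j) = g * c i"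
    and x0B: "\<And>j. j < n \<Longrightarrow> (\<Sum>i<m. x0 i * B i j) = g * f j"
    and x0c: "(\<Sum>i<m. x0 i * c i) = 1" and fy0: "(\<Sum>j<n. f j * y0 j) = 1"
    and gB: "\<And>i j. i < m \<Longrightarrow> j < n \<Longrightarrow> g dvd B i j"
    by (rule smith_step[where A = B, OF nz]) blast
  have g0: "g \<noteq> 0" using g by auto
  obtain x where xC: "\<And>t. t < k \<Longrightarrow> (\<Sum>i<m. x i * C i t) = 0"
    and xB: "\<And>j. j < n \<Longrightarrow> (\<Sum>i<m. x i * B i j) = g * f j"
  proof (rule orthogonalize[where k = k and m = m and L = L and C = C and n = n and B = B and x = x0])
  qed (use st' x0B in auto)
  obtain y where Fy: "\<And>t. t < k \<Longrightarrow> (\<Sum>j<n. F t j * y j) = 0"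
    and By: "\<And>i. i < m \<Longrightarrow> (\<Sum>j<n. B i j * y j) = g * c i"
  proof (rule orthogonalize[where k = k and m = n and L = "\<lambda>s j. R j s" and C = "\<lambda>j s. F s j"
        and n = m and B = "\<lambda>j i. B i j" and x = y0])
  qed (use st' By0 in \<open>auto simp: mult.commute\<close>)
  \<comment> \<open>The new column \<open>c = B y / g\<close> is orthogonal to \<open>L\<close> because \<open>L B = 0\<close>; likewise for the new row \<open>f\<close>.\<close>
  have Lc: "(\<Sum>i<m. L s i * c i) = 0" if "s < k" for s
  proof -
    have "g * (\<Sum>i<m. L s i * c i) = (\<Sum>i<m. \<Sum>j<n. (L s i * B i j) * y0 j)"
      unfolding sum_distrib_left
      by (rule sum.cong) (simp_all add: By0[symmetric] mult.left_commute[of g] sum_distrib_left mult.assoc)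
    also have "\<dots> = (\<Sum>j<n. (\<Sum>i<m. L s i * B i j) * y0 j)"
      by (subst sum.swap) (simp add: sum_distrib_right)
    also have "\<dots> = 0" using st' that by simp
    finally show ?thesis using g0 by simp
  qed
  have fR: "(\<Sum>j<n. f j * R j s) = 0" if "s < k" for s
  proof -
    have "g * (\<Sum>j<n. f j * R j s) = (\<Sum>j<n. \<Sum>i<m. x0 i * (B i j * R j s))"
      unfolding sum_distrib_left
      by (rule sum.cong) (simp_all add: x0B[symmetric] mult.assoc[symmetric] sum_distrib_right)
    also have "\<dots> = (\<Sum>i<m. x0 i * (\<Sum>j<n. B i j * R j s))"
      by (subst sum.swap) (simp add: sum_distrib_left)
    also have "\<dots> = 0" using st' that by simp
    finally show ?thesis using g0 by simp
  qed
  have xc: "(\<Sum>i<m. x i * c i) = 1"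
  proof -
    have "g * (\<Sum>i<m. x i * c i) = (\<Sum>i<m. \<Sum>j<n. x i * (B i j * y0 j))"
      unfolding sum_distrib_left
      by (rule sum.cong) (simp_all add: By0[symmetric] mult.left_commute[of g] sum_distrib_left)
    also have "\<dots> = (\<Sum>j<n. (\<Sum>i<m. x i * B i j) * y0 j)"
      by (subst sum.swap) (simp add: sum_distrib_right mult.assoc)
    also have "\<dots> = g * (\<Sum>j<n. f j * y0 j)"
      by (simp add: xB sum_distrib_left mult.assoc)
    finally show ?thesis using g0 by (simp add: fy0)
  qed
  have fy: "(\<Sum>j<n. f j * y j) = 1"
  proof -
    have "g * (\<Sum>j<n. f j * y j) = (\<Sum>j<n. \<Sum>i<m. x0 i * (B i j * y j))"
      unfolding sum_distrib_left
      by (rule sum.cong) (simp_all add: x0B[symmetric] mult.assoc[symmetric] sum_distrib_right)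
    also have "\<dots> = (\<Sum>i<m. x0 i * (\<Sum>j<n. B i j * y j))"
      by (subst sum.swap) (simp add: sum_distrib_left)
    also have "\<dots> = g * (\<Sum>i<m. x0 i * c i)"
      by (simp add: By sum_distrib_left mult.left_commute)
    finally show ?thesis using g0 by (simp add: x0c)
  qed
  have dg: "d (k - 1) dvd g" if "0 < k"
  proof -
    have "g = (\<Sum>i<m. x0 i * (\<Sum>j<n. B i j * y0 j))"
      using x0c by (simp add: By0 mult.left_commute[of _ g] flip: sum_distrib_left)
    also have "d (k - 1) dvd \<dots>"
      using st' that by (intro dvd_sum dvd_mult dvd_mult2) auto
    finally show ?thesis .
  qed
  define d' where "d' s = (if s < k then d s else g)" for s
  define C' where "C' i s = (if s < k then C i s else c i)" for i s
  define F' where "F' s j = (if s < k then F s j else f j)" for s j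
  define L' where "L' s i = (if s < k then L s i else x i)" for s i
  define R' where "R' j s = (if s < k then R j s else y j)" for j s
  define B' where "B' i j = B i j - g * c i * f j" for i j
  have "smith_state m n A (Suc k) d' C' F' L' R' B'"
    unfolding smith_state_def
  proof (intro conjI allI impI)
    fix s t assume "s < Suc k" "t < Suc k"
    thus "(\<Sum>i<m. L' s i * C' i t) = (if s = t then 1 else 0)"
      using st' by (auto simp: L'_def C'_def Lc xC xc less_Suc_eq)
    from \<open>s < Suc k\<close> \<open>t < Suc k\<close> show "(\<Sum>j<n. F' s j * R' j t) = (if s = t then 1 else 0)"
      using st' by (auto simp: F'_def R'_def fR Fy fy less_Suc_eq)
  next
    fix s j assume s: "s < Suc k" and j: "j < n"
    have "(\<Sum>i<m. L' s i * B' i j) = (\<Sum>i<m. L' s i * B i j) - g * (\<Sum>i<m. L' s i * c i) * f j"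
      by (simp add: B'_def right_diff_distrib sum_subtractf sum_distrib_left sum_distrib_right mult_ac)
    thus "(\<Sum>i<m. L' s i * B' i j) = 0"
      using s j st' by (auto simp: L'_def less_Suc_eq Lc xc xB)
  next
    fix i s assume i: "i < m" and s: "s < Suc k"
    have "(\<Sum>j<n. B' i j * R' j s) = (\<Sum>j<n. B i j * R' j s) - g * c i * (\<Sum>j<n. f j * R' j s)"
      unfolding B'_def left_diff_distrib sum_subtractf sum_distrib_left mult.assoc ..
    thus "(\<Sum>j<n. B' i j * R' j s) = 0"
      using s i st' by (auto simp: R'_def less_Suc_eq fR fy By)
  next
    fix i j assume "i < m" "j < n"
    thus "A i j = (\<Sum>s<Suc k. C' i s * d' s * F' s j) + B' i j"
      using st' by (auto simp: C'_def d'_def F'_def B'_def)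
  next
    fix s assume "s < Suc k"
    thus "lead_coeff (d' s) = 1" using st' g by (auto simp: d'_def)
  next
    fix s assume "Suc s < Suc k"
    thus "d' s dvd d' (Suc s)"
      using st' dg by (cases "Suc s < k") (auto simp: d'_def not_less less_Suc_eq)
  next
    fix i j assume "i < m" "j < n"
    thus "d' (Suc k - 1) dvd B' i j" using gB by (auto simp: d'_def B'_def)
  qed
  thus ?thesis by blast
qed

text \<open>
  Padding with zeroes turns \<open>L C = 1\<close> into a product of square matrices, one of which is singular
  if \<open>k > m\<close>.
\<close>

lemma left_inverse_bound:
  fixes L C :: "nat \<Rightarrow> nat \<Rightarrow> 'a :: idom"
  assumes "\<forall>s<k. \<forall>t<k. (\<Sum>i<m. L s i * C i t) = (if s = t then 1 else 0)"
  shows "k \<le> m"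
proof (rule ccontr)
  assume "\<not> k \<le> m"
  hence km: "m < k" by simp
  define P where "P = Matrix.mat k k (\<lambda>(s, i). if i < m then L s i else 0)"
  define Q where "Q = Matrix.mat k k (\<lambda>(i, t). if i < m then C i t else 0)"
  have PQ: "P \<in> carrier_mat k k" "Q \<in> carrier_mat k k" by (auto simp: P_def Q_def)
  have "P * Q = 1\<^sub>m k"
  proof (rule eq_matI)
    fix s t assume "s < dim_row (1\<^sub>m k :: 'a mat)" "t < dim_col (1\<^sub>m k :: 'a mat)"
    hence st: "s < k" "t < k" by auto
    have "(P * Q) $$ (s, t) = (\<Sum>i\<in>{0..<k}. if i < m then L s i * C i t else 0)"
      using st by (auto simp: P_def Q_def scalar_prod_def intro!: sum.cong)
    also have "\<dots> = (\<Sum>i<m. L s i * C i t)"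
      using km by (intro sum.mono_neutral_cong_right) auto
    finally show "(P * Q) $$ (s, t) = 1\<^sub>m k $$ (s, t)"
      using assms st by simp
  qed (auto simp: P_def Q_def)
  hence "Determinant.det P * Determinant.det Q = 1"
    using det_mult[OF PQ] by simp
  moreover have "Determinant.det Q = 0"
    unfolding Determinant.det_def'[OF PQ(2)]
  proof (rule sum.neutral, rule ballI)
    fix p assume "p \<in> {p. p permutes {0..<k}}"
    hence "p m < k" using km by (auto simp: permutes_def)
    hence "(\<Prod>i = 0..<k. Q $$ (i, p i)) = 0"
      using km by (intro prod_zero) (auto simp: Q_def intro!: bexI[of _ m])
    thus "signof p * (\<Prod>i = 0..<k. Q $$ (i, p i)) = 0" by simp
  qed
  ultimately show False by simp
qed

text \<open>Each step raises the number of columns of \<open>C\<close>, so the process stops after at most \<open>m\<close> steps.\<close>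

lemma smith_form_functions:
  fixes A :: "nat \<Rightarrow> nat \<Rightarrow> complex poly"
  shows "\<exists>k d C F L R B. smith_state m n A k d C F L R B \<and> (\<forall>i<m. \<forall>j<n. B i j = 0)"
proof (rule ccontr)
  assume none: "\<not> ?thesis"
  have "\<exists>d C F L R B. smith_state m n A k d C F L R B" for k
  proof (induction k)
    case 0
    have "smith_state m n A 0 (\<lambda>_. 0) A A A A A" by (simp add: smith_state_def)
    thus ?case by blast
  next
    case (Suc k)
    then obtain d C F L R B where st: "smith_state m n A k d C F L R B" by blast
    with none obtain i j where "i < m" "j < n" "B i j \<noteq> 0" by blast
    thus ?case using smith_state_step[OF st] by blast
  qed
  then obtain d C F L R B where "smith_state m n A (Suc m) d C F L R B" by blast
  hence "Suc m \<le> m"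
    unfolding smith_state_def by (elim conjE) (rule left_inverse_bound[where L = L and C = C])
  thus False by simp
qed

lemma smith_form:
  fixes A :: "complex poly mat"
  obtains k d C F where "C \<in> carrier_mat (dim_row A) k" "F \<in> carrier_mat k (dim_col A)"
    "left_invertible_polymat C" "right_invertible_polymat F"
    "A = C * Matrix.mat k k (\<lambda>(i, j). if i = j then d i else 0) * F"
    "\<And>s. s < k \<Longrightarrow> lead_coeff (d s) = 1" "\<And>s. Suc s < k \<Longrightarrow> d s dvd d (Suc s)"
proof -
  define m n where "m = dim_row A" and "n = dim_col A"
  obtain k d C F L R B where st: "smith_state m n (\<lambda>i j. A $$ (i, j)) k d C F L R B"
    and B: "\<forall>i<m. \<forall>j<n. B i j = 0"
    using smith_form_functions[of m n] by blast
  note st = st[unfolded smith_state_def]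
  define CM FM LM RM DM where "CM = Matrix.mat m k (\<lambda>(i, s). C i s)"
    and "FM = Matrix.mat k n (\<lambda>(s, j). F s j)" and "LM = Matrix.mat k m (\<lambda>(s, i). L s i)"
    and "RM = Matrix.mat n k (\<lambda>(j, s). R j s)"
    and "DM = Matrix.mat k k (\<lambda>(i, j). if i = j then d i else 0)"
  note defs = CM_def FM_def LM_def RM_def DM_def
  show thesis
  proof (rule that[of CM k FM d])
    show "CM \<in> carrier_mat (dim_row A) k" "FM \<in> carrier_mat k (dim_col A)"
      by (auto simp: defs m_def n_def)
    have "LM * CM = 1\<^sub>m k"
      using st by (intro eq_matI) (auto simp: defs scalar_prod_def atLeast0LessThan)
    thus "left_invertible_polymat CM"
      unfolding left_invertible_polymat_def by (intro bexI[of _ LM]) (auto simp: defs)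
    have "FM * RM = 1\<^sub>m k"
      using st by (intro eq_matI) (auto simp: defs scalar_prod_def atLeast0LessThan)
    thus "right_invertible_polymat FM"
      unfolding right_invertible_polymat_def by (intro bexI[of _ RM]) (auto simp: defs)
    have CD: "CM * DM = Matrix.mat m k (\<lambda>(i, s). C i s * d s)"
      by (intro eq_matI) (auto simp: defs scalar_prod_def if_distrib cong: if_cong)
    show "A = CM * Matrix.mat k k (\<lambda>(i, j). if i = j then d i else 0) * FM"
      unfolding DM_def[symmetric] CD
    proof (rule eq_matI)
      fix i j assume "i < dim_row (Matrix.mat m k (\<lambda>(i, s). C i s * d s) * FM)"
        "j < dim_col (Matrix.mat m k (\<lambda>(i, s). C i s * d s) * FM)"
      hence ij: "i < m" "j < n" by (auto simp: defs)
      have "A $$ (i, j) = (\<Sum>s<k. C i s * d s * F s j)"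
        using st B ij by simp
      thus "A $$ (i, j) = (Matrix.mat m k (\<lambda>(i, s). C i s * d s) * FM) $$ (i, j)"
        using ij by (simp add: defs scalar_prod_def atLeast0LessThan)
    qed (auto simp: defs m_def n_def)
    show "lead_coeff (d s) = 1" if "s < k" for s
      using st that by blast
    show "d s dvd d (Suc s)" if "Suc s < k" for s
      using st that by blast
  qed
qed


section \<open>The Smith-McMillan form\<close>

interpretation to_fract: inj_comm_ring_hom "to_fract :: complex poly \<Rightarrow> ratfun"
  by unfold_locales auto

text \<open>
  Applied at almost every point, this gives the normal rank of a matrix in Smith-McMillan form.
\<close>

lemma rank_mult_one_sided_inverses:
  fixes P Q L R :: "complex mat"
  assumes P: "P \<in> carrier_mat m r" and Q: "Q \<in> carrier_mat r n"
    and L: "L \<in> carrier_mat r m" "L * P = 1\<^sub>m r" and R: "R \<in> carrier_mat n r" "Q * R = 1\<^sub>m r"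
  shows "vec_space.rank m (P * Q) = r"
proof -
  interpret V: vec_space "TYPE(complex)" m .
  have PQ: "P * Q \<in> carrier_mat m n" using P Q by simp
  have "V.col_space (P * Q) = V.col_space P"
  proof (rule Set.set_eqI)
    fix y
    show "y \<in> V.col_space (P * Q) \<longleftrightarrow> y \<in> V.col_space P"
    proof
      assume "y \<in> V.col_space (P * Q)"
      then obtain x where x: "x \<in> carrier_vec n" "y = P * Q *\<^sub>v x"
        unfolding V.col_space_eq[OF PQ] using P Q by auto
      hence "y = P *\<^sub>v (Q *\<^sub>v x)" using P Q by simp
      thus "y \<in> V.col_space P"
        unfolding V.col_space_eq[OF P] using x P Q by auto
    next
      assume "y \<in> V.col_space P"
      then obtain x where x: "x \<in> carrier_vec r" "y = P *\<^sub>v x"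
        unfolding V.col_space_eq[OF P] using P by auto
      have "Q *\<^sub>v (R *\<^sub>v x) = x"
        using assoc_mult_mat_vec[OF Q R(1) x(1)] R(2) x(1) by simp
      hence "y = P * Q *\<^sub>v (R *\<^sub>v x)"
        using assoc_mult_mat_vec[OF P Q, of "R *\<^sub>v x"] R(1) x by simp
      thus "y \<in> V.col_space (P * Q)"
        unfolding V.col_space_eq[OF PQ] using x P Q R by auto
    qed
  qed
  hence "V.rank (P * Q) = V.rank P"
    unfolding V.rank_def V.col_space_def by simp
  also have "\<dots> = r"
  proof (rule V.lin_indpt_full_rank[OF P])
    show dist: "distinct (cols P)"
    proof (rule ccontr)
      assume "\<not> distinct (cols P)"
      then obtain i j where ij: "i < r" "j < r" "i \<noteq> j" "col P i = col P j"
        using P by (auto simp: distinct_conv_nth)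
      have "(L * P) $$ (i, i) = (L * P) $$ (i, j)"
        using ij P L(1) by simp
      thus False using ij by (simp add: L(2))
    qed
    show "V.lin_indpt (set (cols P))"
    proof
      assume "V.lin_dep (set (cols P))"
      then obtain v where v: "v \<in> carrier_vec r" "v \<noteq> 0\<^sub>v r" "P *\<^sub>v v = 0\<^sub>v m"
        using V.lin_depE[OF P _ dist] by blast
      have "v = L * P *\<^sub>v v" using v(1) by (simp add: L(2))
      also have "\<dots> = L *\<^sub>v (P *\<^sub>v v)" using L(1) P v(1) by simp
      also have "\<dots> = 0\<^sub>v r" using L(1) by (auto simp: v(3))
      finally show False using v(2) by simp
    qed
  qed
  finally show ?thesis .
qed

lemma eval_ratfun_mult:
  assumes "regular_at (Fin z) f" "regular_at (Fin z) g"
  shows "eval_ratfun (f * g) z = eval_ratfun f z * eval_ratfun g z"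
  using assms by (elim regular_at_FinE) (simp add: eval_ratfun_Fract)

lemma eval_ratfun_add:
  assumes "regular_at (Fin z) f" "regular_at (Fin z) g"
  shows "eval_ratfun (f + g) z = eval_ratfun f z + eval_ratfun g z"
  using assms by (elim regular_at_FinE) (simp add: eval_ratfun_Fract add_frac_eq)

lemma eval_ratfun_sum:
  assumes "\<And>i. i \<in> S \<Longrightarrow> regular_at (Fin z) (f i)"
  shows "eval_ratfun (sum f S) z = (\<Sum>i\<in>S. eval_ratfun (f i) z)"
  using assms
proof (induction S rule: infinite_finite_induct)
  case (insert i S)
  thus ?case by (simp add: eval_ratfun_add regular_at_sum del: regular_at.simps)
qed (simp_all add: eval_ratfun_def)

lemma eval_ratmat_mult:
  assumes G: "G \<in> carrier_mat m k" "regular_mat_at (Fin z) G"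
    and H: "H \<in> carrier_mat k n" "regular_mat_at (Fin z) H"
  shows "eval_ratmat (G * H) z = eval_ratmat G z * eval_ratmat H z"
proof (rule eq_matI)
  fix i j
  assume "i < dim_row (eval_ratmat G z * eval_ratmat H z)"
    "j < dim_col (eval_ratmat G z * eval_ratmat H z)"
  hence ij: "i < m" "j < n" using G H by (auto simp: eval_ratmat_def)
  have reg: "regular_at (Fin z) (G $$ (i, l))" "regular_at (Fin z) (H $$ (l, j))" if "l < k" for l
    using G H ij that by (auto simp: regular_mat_at_def simp del: regular_at.simps)
  have "eval_ratmat (G * H) z $$ (i, j) = eval_ratfun (\<Sum>l = 0..<k. G $$ (i, l) * H $$ (l, j)) z"
    using G H ij by (simp add: eval_ratmat_def scalar_prod_def)
  also have "\<dots> = (\<Sum>l = 0..<k. eval_ratfun (G $$ (i, l)) z * eval_ratfun (H $$ (l, j)) z)"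
    using reg by (subst eval_ratfun_sum) (auto simp: eval_ratfun_mult regular_at_mult
        simp del: regular_at.simps)
  finally show "eval_ratmat (G * H) z $$ (i, j) = (eval_ratmat G z * eval_ratmat H z) $$ (i, j)"
    using G H ij by (simp add: eval_ratmat_def scalar_prod_def)
qed (use G H in \<open>auto simp: eval_ratmat_def\<close>)

lemma eval_ratmat_one: "eval_ratmat (1\<^sub>m n) z = 1\<^sub>m n"
  by (rule eq_matI) (auto simp: eval_ratmat_def eval_ratfun_def)

lemma normal_rankI:
  assumes "finite S" "\<And>z. z \<notin> S \<Longrightarrow> vec_space.rank (dim_row G) (eval_ratmat G z) = r"
  shows "normal_rank G = r"
  unfolding normal_rank_def
proof (rule the_equality)
  have "AE z in lborel. z \<notin> S"
    using finite_imp_null_set_lborel[OF assms(1)] by (rule AE_not_in)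
  thus *: "AE z in lborel. vec_space.rank (dim_row G) (eval_ratmat G z) = r"
    by eventually_elim (rule assms(2))
  fix s assume "AE z in lborel. vec_space.rank (dim_row G) (eval_ratmat G z) = s"
  with * have "AE z in (lborel :: complex measure). s = r"
    by eventually_elim simp
  moreover have "ae_filter (lborel :: complex measure) \<noteq> bot"
    by (simp add: ae_filter_eq_bot_iff)
  ultimately show "s = r"
    by (simp add: eventually_const)
qed

text \<open>The diagonal matrix with the given entries.\<close>

definition diag :: "nat \<Rightarrow> (nat \<Rightarrow> 'a :: zero) \<Rightarrow> 'a mat" where
  "diag r d = Matrix.mat r r (\<lambda>(i, j). if i = j then d i else 0)"

lemma diag_carrier [simp]: "diag r d \<in> carrier_mat r r"
  by (simp add: diag_def)

lemma diag_dim [simp]: "dim_row (diag r d) = r" "dim_col (diag r d) = r"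
  by (simp_all add: diag_def)

lemma diag_mult: "diag r d * diag r e = diag r (\<lambda>i. d i * (e i :: 'a :: semiring_0))"
proof (rule eq_matI)
  fix i j assume ij: "i < dim_row (diag r (\<lambda>i. d i * e i))" "j < dim_col (diag r (\<lambda>i. d i * e i))"
  hence "(diag r d * diag r e) $$ (i, j) =
      (\<Sum>k\<in>{0..<r}. (if i = k then d i else 0) * (if k = j then e k else 0))"
    by (simp add: diag_def scalar_prod_def)
  also have "\<dots> = (\<Sum>k\<in>{0..<r}. if k = i then if i = j then d i * e i else 0 else 0)"
    by (rule sum.cong) auto
  finally show "(diag r d * diag r e) $$ (i, j) = diag r (\<lambda>i. d i * e i) $$ (i, j)"
    using ij by (simp add: diag_def)
qed auto

lemma diag_add: "diag r d + diag r e = diag r (\<lambda>i. d i + (e i :: 'a :: semiring_0))"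
  by (rule eq_matI) (auto simp: diag_def)

lemma diag_one: "(\<And>i. i < r \<Longrightarrow> d i = 1) \<Longrightarrow> diag r d = 1\<^sub>m r"
  by (rule eq_matI) (auto simp: diag_def)

lemma diag_cong: "(\<And>i. i < r \<Longrightarrow> d i = e i) \<Longrightarrow> diag r d = diag r e"
  by (rule eq_matI) (auto simp: diag_def)

lemma map_mat_diag: "h 0 = 0 \<Longrightarrow> map_mat h (diag r d) = diag r (\<lambda>i. h (d i))"
  by (rule eq_matI) (auto simp: diag_def)

lemma diag_transpose: "(diag r d)\<^sup>T = diag r d"
  by (rule eq_matI) (auto simp: diag_def)

lemma det_diag: "Determinant.det (diag r d) = (\<Prod>i<r. d i :: 'a :: comm_ring_1)"
proof -
  have "Determinant.det (diag r d) = prod_list (diag_mat (diag r d))"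
    by (rule det_upper_triangular[of _ r]) (auto simp: diag_def upper_triangular_def)
  also have "diag_mat (diag r d) = map d [0..<r]"
    by (rule nth_equalityI) (auto simp: diag_mat_def diag_def)
  finally show ?thesis
    by (simp add: prod.distinct_set_conv_list[symmetric] atLeast0LessThan)
qed

lemma normal_rank_factorization:
  assumes C: "C \<in> carrier_mat m r" "left_invertible_polymat C"
    and F: "F \<in> carrier_mat r n" "right_invertible_polymat F"
    and G: "G = map_mat to_fract C * diag r (\<lambda>i. Fraction_Field.Fract (e i) (p i)) * map_mat to_fract F"
    and nz: "\<And>i. i < r \<Longrightarrow> e i \<noteq> 0" "\<And>i. i < r \<Longrightarrow> p i \<noteq> 0"
  shows "normal_rank G = r"
proof (rule normal_rankI)
  show "finite (\<Union>i<r. {z. poly (e i * p i) z = 0})"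
    using nz by (intro finite_UN_I poly_roots_finite) auto
next
  fix z assume "z \<notin> (\<Union>i<r. {z. poly (e i * p i) z = 0})"
  hence z: "poly (e i) z \<noteq> 0" "poly (p i) z \<noteq> 0" if "i < r" for i using that by auto
  obtain L where L: "L \<in> carrier_mat r m" "L * C = 1\<^sub>m r"
    using C unfolding left_invertible_polymat_def by auto
  obtain R where R: "R \<in> carrier_mat n r" "F * R = 1\<^sub>m r"
    using F unfolding right_invertible_polymat_def by auto
  let ?D = "diag r (\<lambda>i. Fraction_Field.Fract (e i) (p i))"
  let ?D' = "diag r (\<lambda>i. Fraction_Field.Fract (p i) (e i))"
  have reg: "regular_mat_at (Fin z) ?D" "regular_mat_at (Fin z) ?D'"
    using z by (auto simp: regular_mat_at_def diag_def intro!: regular_at_FinI simp del: regular_at.simps)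
  note reg = reg regular_mat_at_to_fract[of z]
  have DD': "?D * ?D' = 1\<^sub>m r"
    unfolding diag_mult using nz by (intro diag_one) (auto simp: Fract_conv_to_fract)
  define Q where "Q = ?D * map_mat to_fract F"
  define R' where "R' = map_mat to_fract R * ?D'"
  have Q: "Q \<in> carrier_mat r n" "regular_mat_at (Fin z) Q"
    using F reg by (auto simp: Q_def intro!: regular_mat_at_mult)
  have R': "R' \<in> carrier_mat n r" "regular_mat_at (Fin z) R'"
    using R reg by (auto simp: R'_def intro!: regular_mat_at_mult)
  have "Q * R' = ?D * (map_mat to_fract (F * R)) * ?D'"
    unfolding Q_def R'_def to_fract.mat_hom_mult[OF F(1) R(1)] using F(1) R(1)
    by (simp add: assoc_mult_mat[of _ r r _ n _ r] assoc_mult_mat[of _ r n _ r _ r]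
        assoc_mult_mat[of _ r r _ r _ r])
  hence "Q * R' = 1\<^sub>m r" by (simp add: R(2) to_fract.mat_hom_one DD' right_mult_one_mat[of _ r r])
  hence QR: "eval_ratmat Q z * eval_ratmat R' z = 1\<^sub>m r"
    using eval_ratmat_mult[OF Q R'] by (simp add: eval_ratmat_one)
  have "map_mat to_fract L * map_mat to_fract C = 1\<^sub>m r"
    using L(2) to_fract.mat_hom_mult[OF L(1) C(1)] by (simp add: to_fract.mat_hom_one)
  hence LC: "eval_ratmat (map_mat to_fract L) z * eval_ratmat (map_mat to_fract C) z = 1\<^sub>m r"
    using eval_ratmat_mult[of "map_mat to_fract L" r m z "map_mat to_fract C" r] L C reg
    by (simp add: eval_ratmat_one)
  have GQ: "G = map_mat to_fract C * Q"
    unfolding G Q_def using C F by (simp add: assoc_mult_mat[of _ m r _ r _ n])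
  have "dim_row G = m" using C by (simp add: G)
  moreover have "eval_ratmat G z = eval_ratmat (map_mat to_fract C) z * eval_ratmat Q z"
    unfolding GQ using C reg Q by (intro eval_ratmat_mult) auto
  moreover have "vec_space.rank m (eval_ratmat (map_mat to_fract C) z * eval_ratmat Q z) = r"
    by (rule rank_mult_one_sided_inverses[OF _ _ _ LC _ QR])
       (use C L Q R' in \<open>auto simp: eval_ratmat_def\<close>)
  ultimately show "vec_space.rank (dim_row G) (eval_ratmat G z) = r" by simp
qed

lemma lead_coeff_snd_quot_of_fract: "lead_coeff (snd (quot_of_fract (f :: ratfun))) = 1"
  using unit_factor_snd_quot_of_fract[of f] by (auto simp: unit_factor_poly_def one_pCons)

lemma common_denominator:
  fixes G :: ratmat
  obtains q N where "lead_coeff q = 1" "N \<in> carrier_mat (dim_row G) (dim_col G)"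
    "G = Matrix.mat (dim_row G) (dim_col G) (\<lambda>ij. Fraction_Field.Fract (N $$ ij) q)"
proof -
  define I where "I = {..<dim_row G} \<times> {..<dim_col G}"
  define q where "q = (\<Prod>ij\<in>I. snd (quot_of_fract (G $$ ij)))"
  have lead: "lead_coeff q = 1"
    unfolding q_def lead_coeff_prod by (simp add: lead_coeff_snd_quot_of_fract)
  define N where "N = Matrix.mat (dim_row G) (dim_col G)
    (\<lambda>ij. fst (quot_of_fract (G $$ ij)) * (q div snd (quot_of_fract (G $$ ij))))"
  have "G $$ ij = Fraction_Field.Fract (N $$ ij) q" if "ij \<in> I" for ij
  proof -
    let ?a = "fst (quot_of_fract (G $$ ij))" and ?b = "snd (quot_of_fract (G $$ ij))"
    have "?b dvd q" unfolding q_def using that by (intro dvd_prodI) (auto simp: I_def)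
    hence q: "q = q div ?b * ?b" by simp
    have "q \<noteq> 0" using lead by auto
    moreover have "?a * (q div ?b) * ?b = ?a * q" by (subst (2) q) (simp add: mult_ac)
    ultimately have "Fraction_Field.Fract (?a * (q div ?b)) q = Fraction_Field.Fract ?a ?b"
      using eq_fract(1)[of q ?b "?a * (q div ?b)" ?a] by simp
    thus ?thesis using that by (auto simp: N_def I_def)
  qed
  hence "G = Matrix.mat (dim_row G) (dim_col G) (\<lambda>ij. Fraction_Field.Fract (N $$ ij) q)"
    by (intro eq_matI) (auto simp: I_def)
  moreover have "N \<in> carrier_mat (dim_row G) (dim_col G)" by (simp add: N_def)
  ultimately show thesis using that lead by blast
qed

text \<open>
  Write \<open>G = N/q\<close> with a polynomial matrix \<open>N\<close> and reduce the fractions \<open>d\<^sub>i/q\<close> of the Smith form of \<open>N\<close>.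
  Divisibility \<open>d\<^sub>i | d\<^sub>i\<^sub>+\<^sub>1\<close> passes to the numerators and, reversed, to the denominators by coprimality.
\<close>

lemma is_smith_mcmillan_exists: "\<exists>\<epsilon> \<psi>. is_smith_mcmillan G \<epsilon> \<psi>"
proof -
  define m n where "m = dim_row G" and "n = dim_col G"
  obtain q N where q: "lead_coeff q = 1" and N: "N \<in> carrier_mat m n"
    and GN: "G = Matrix.mat m n (\<lambda>ij. Fraction_Field.Fract (N $$ ij) q)"
    unfolding m_def n_def by (rule common_denominator)
  have q0: "q \<noteq> 0" using q by auto
  have dN: "dim_row N = m" "dim_col N = n" using N by auto
  obtain r d C F where C: "C \<in> carrier_mat m r" "left_invertible_polymat C"
    and F: "F \<in> carrier_mat r n" "right_invertible_polymat F"
    and NC: "N = C * diag r d * F"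
    and d: "\<And>s. s < r \<Longrightarrow> lead_coeff (d s) = 1" "\<And>s. Suc s < r \<Longrightarrow> d s dvd d (Suc s)"
    by (rule smith_form[of N, folded diag_def, unfolded dN]) blast
  define f where "f i = Fraction_Field.Fract (d i) q" for i
  define e p where "e i = fst (quot_of_fract (f i))" and "p i = snd (quot_of_fract (f i))" for i
  have ep: "Fraction_Field.Fract (e i) (p i) = f i" for i by (simp add: e_def p_def)
  have cop: "coprime (e i) (p i)" for i unfolding e_def p_def by (rule coprime_quot_of_fract)
  have p: "lead_coeff (p i) = 1" for i unfolding p_def by (rule lead_coeff_snd_quot_of_fract)
  have p0: "p i \<noteq> 0" for i using p[of i] by auto
  have eq: "e i * q = d i * p i" for i
    using ep[of i] p0[of i] q0 by (simp add: f_def eq_fract)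
  have e: "lead_coeff (e i) = 1" if "i < r" for i
    using arg_cong[OF eq[of i], of lead_coeff] q p[of i] d(1)[OF that] by (simp add: lead_coeff_mult)
  have e0: "e i \<noteq> 0" if "i < r" for i using e[OF that] by auto
  have chain: "e i dvd e (Suc i) \<and> p (Suc i) dvd p i" if i: "Suc i < r" for i
  proof -
    obtain c where c: "d (Suc i) = d i * c" using d(2)[OF i] by (rule dvdE)
    have "(e (Suc i) * p i) * q = (c * e i * p (Suc i)) * q"
    proof -
      have "(e (Suc i) * p i) * q = (e (Suc i) * q) * p i" by (simp only: mult_ac)
      also have "\<dots> = c * (d i * p i) * p (Suc i)" unfolding eq c by (simp only: mult_ac)
      also have "\<dots> = (c * e i * p (Suc i)) * q" unfolding eq[symmetric] by (simp only: mult_ac)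
      finally show ?thesis .
    qed
    hence *: "e (Suc i) * p i = c * e i * p (Suc i)" using q0 by simp
    have "p (Suc i) dvd e (Suc i) * p i" unfolding * by simp
    moreover have "e i dvd e (Suc i) * p i" unfolding * by simp
    ultimately show ?thesis
      using cop by (metis coprime_commute coprime_dvd_mult_left_iff coprime_dvd_mult_right_iff)
  qed
  have G: "G = map_mat to_fract C * diag r (\<lambda>i. Fraction_Field.Fract (e i) (p i)) * map_mat to_fract F"
  proof -
    have D: "diag r f = (1 / to_fract q) \<cdot>\<^sub>m map_mat to_fract (diag r d)"
      by (rule eq_matI) (auto simp: diag_def f_def Fract_conv_to_fract)
    have "G = (1 / to_fract q) \<cdot>\<^sub>m map_mat to_fract N"
      unfolding GN using N by (intro eq_matI) (auto simp: Fract_conv_to_fract)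
    also have "map_mat to_fract N = map_mat to_fract C * map_mat to_fract (diag r d) * map_mat to_fract F"
      unfolding NC using to_fract.mat_hom_mult[OF C(1) diag_carrier[of r d]]
        to_fract.mat_hom_mult[of "C * diag r d" m r F n] C F by simp
    also have "(1 / to_fract q) \<cdot>\<^sub>m \<dots> = map_mat to_fract C * diag r f * map_mat to_fract F"
      unfolding D using C F
      by (simp add: mult_smult_distrib[of _ m r _ r] mult_smult_assoc_mat[of _ m r _ n])
    finally show ?thesis by (simp add: ep)
  qed
  have "normal_rank G = r"
    by (rule normal_rank_factorization[OF C F G e0 p0])
  moreover have "diag r (\<lambda>i. Fraction_Field.Fract (e i) (p i)) =
      diag r (\<lambda>i. Fraction_Field.Fract (map e [0..<r] ! i) (map p [0..<r] ! i))"
    by (rule diag_cong) simp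
  with G have "\<exists>C\<in>carrier_mat m r. \<exists>F\<in>carrier_mat r n.
      left_invertible_polymat C \<and> right_invertible_polymat F \<and> G = map_mat to_fract C *
      diag r (\<lambda>i. Fraction_Field.Fract (map e [0..<r] ! i) (map p [0..<r] ! i)) * map_mat to_fract F"
    using C F by metis
  ultimately have "is_smith_mcmillan G (map e [0..<r]) (map p [0..<r])"
    unfolding is_smith_mcmillan_def Let_def m_def[symmetric] n_def[symmetric] diag_def
    using e p cop chain by simp
  thus ?thesis by blast
qed

lemma is_smith_mcmillan_sm: "is_smith_mcmillan G (sm_num G) (sm_den G)"
proof -
  have "case smith_mcmillan G of (\<epsilon>, \<psi>) \<Rightarrow> is_smith_mcmillan G \<epsilon> \<psi>"
    unfolding smith_mcmillan_def by (rule someI_ex) (use is_smith_mcmillan_exists in auto)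
  thus ?thesis
    unfolding sm_num_def sm_den_def by (simp only: split_beta)
qed

text \<open>The ingredients of the form in terms of indexed families.\<close>

lemma is_smith_mcmillanE:
  assumes "is_smith_mcmillan G \<epsilon> \<psi>"
  obtains r C F where "r = normal_rank G" "length \<epsilon> = r" "length \<psi> = r"
    "C \<in> carrier_mat (dim_row G) r" "left_invertible_polymat C"
    "F \<in> carrier_mat r (dim_col G)" "right_invertible_polymat F"
    "G = map_mat to_fract C * diag r (\<lambda>i. Fraction_Field.Fract (\<epsilon> ! i) (\<psi> ! i)) * map_mat to_fract F"
    "\<And>i. i < r \<Longrightarrow> lead_coeff (\<epsilon> ! i) = 1" "\<And>i. i < r \<Longrightarrow> lead_coeff (\<psi> ! i) = 1"
    "\<And>i. i < r \<Longrightarrow> coprime (\<epsilon> ! i) (\<psi> ! i)"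
    "\<And>i. Suc i < r \<Longrightarrow> \<epsilon> ! i dvd \<epsilon> ! Suc i" "\<And>i. Suc i < r \<Longrightarrow> \<psi> ! Suc i dvd \<psi> ! i"
proof -
  obtain C F where CF: "C \<in> carrier_mat (dim_row G) (normal_rank G)"
    "F \<in> carrier_mat (normal_rank G) (dim_col G)" "left_invertible_polymat C" "right_invertible_polymat F"
    "G = map_mat to_fract C * diag (normal_rank G) (\<lambda>i. Fraction_Field.Fract (\<epsilon> ! i) (\<psi> ! i)) *
      map_mat to_fract F"
    using assms unfolding is_smith_mcmillan_def Let_def diag_def by blast
  show thesis
    by (rule that[OF refl _ _ CF(1,3,2,4,5)])
       (use assms in \<open>simp_all add: is_smith_mcmillan_def Let_def\<close>)
qed

lemma is_smith_mcmillan_transpose: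
  assumes "is_smith_mcmillan G \<epsilon> \<psi>"
  shows "is_smith_mcmillan G\<^sup>T \<epsilon> \<psi>"
  using assms
proof (rule is_smith_mcmillanE)
  fix r C F
  assume r: "r = normal_rank G" "length \<epsilon> = r" "length \<psi> = r"
    and C: "C \<in> carrier_mat (dim_row G) r" "left_invertible_polymat C"
    and F: "F \<in> carrier_mat r (dim_col G)" "right_invertible_polymat F"
    and G: "G = map_mat to_fract C * diag r (\<lambda>i. Fraction_Field.Fract (\<epsilon> ! i) (\<psi> ! i)) *
      map_mat to_fract F"
    and lead: "\<And>i. i < r \<Longrightarrow> lead_coeff (\<epsilon> ! i) = 1" "\<And>i. i < r \<Longrightarrow> lead_coeff (\<psi> ! i) = 1"
  let ?m = "dim_row G" and ?n = "dim_col G"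
  let ?D = "diag r (\<lambda>i. Fraction_Field.Fract (\<epsilon> ! i) (\<psi> ! i))"
  have t: "(map_mat to_fract M)\<^sup>T = map_mat to_fract M\<^sup>T" for M :: "complex poly mat"
    by (rule eq_matI) auto
  have "G\<^sup>T = (map_mat to_fract F)\<^sup>T * (map_mat to_fract C * ?D)\<^sup>T"
    by (subst G, rule transpose_mult[of _ ?m r _ ?n]) (use C F in \<open>auto intro: mult_carrier_mat[of _ _ r]\<close>)
  also have "(map_mat to_fract C * ?D)\<^sup>T = ?D\<^sup>T * (map_mat to_fract C)\<^sup>T"
    by (rule transpose_mult[of _ ?m r _ r]) (use C in auto)
  finally have GT: "G\<^sup>T = map_mat to_fract F\<^sup>T * ?D * map_mat to_fract C\<^sup>T"
    unfolding diag_transpose t using C F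
    by (simp add: assoc_mult_mat[of _ ?n r _ r _ ?m, symmetric])
  obtain L where L: "L \<in> carrier_mat r ?m" "L * C = 1\<^sub>m r"
    using C unfolding left_invertible_polymat_def by auto
  obtain R where R: "R \<in> carrier_mat ?n r" "F * R = 1\<^sub>m r"
    using F unfolding right_invertible_polymat_def by auto
  have CT: "right_invertible_polymat C\<^sup>T"
    unfolding right_invertible_polymat_def using L C transpose_mult[OF L(1) C(1)]
    by (intro bexI[of _ "L\<^sup>T"]) auto
  have FT: "left_invertible_polymat F\<^sup>T"
    unfolding left_invertible_polymat_def using R F transpose_mult[OF F(1) R(1)]
    by (intro bexI[of _ "R\<^sup>T"]) auto
  have rk: "normal_rank G\<^sup>T = r"
    by (rule normal_rank_factorization[OF _ FT _ CT GT]) (use C F lead in fastforce)+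
  have "\<exists>C\<in>carrier_mat (dim_row G\<^sup>T) r. \<exists>F\<in>carrier_mat r (dim_col G\<^sup>T).
      left_invertible_polymat C \<and> right_invertible_polymat F \<and>
      G\<^sup>T = map_mat to_fract C * ?D * map_mat to_fract F"
    using C F CT FT GT by (intro bexI[of _ "F\<^sup>T"] bexI[of _ "C\<^sup>T"]) auto
  thus ?thesis
    using assms unfolding is_smith_mcmillan_def Let_def rk r(1)[symmetric] diag_def by blast
qed


section \<open>Pole degrees via left denominators\<close>

text \<open>Sylvester's determinant identity.\<close>

lemma det_one_plus_mult_commute:
  fixes C N :: "'a :: idom mat"
  assumes C: "C \<in> carrier_mat m r" and N: "N \<in> carrier_mat r m"
  shows "Determinant.det (1\<^sub>m m + C * N) = Determinant.det (1\<^sub>m r + N * C)"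
proof -
  \<comment> \<open>\<open>M\<close> becomes block lower triangular on multiplication by \<open>U\<close> from either side.\<close>
  define M where "M = four_block_mat (1\<^sub>m m) (- C) N (1\<^sub>m r)"
  define U where "U = four_block_mat (1\<^sub>m m) C (0\<^sub>m r m) (1\<^sub>m r)"
  have M: "M \<in> carrier_mat (m + r) (m + r)" and U: "U \<in> carrier_mat (m + r) (m + r)"
    by (auto simp: M_def U_def)
  have detU: "Determinant.det U = 1"
    unfolding U_def by (subst det_four_block_mat_lower_left_zero[OF _ C]) auto
  have CC: "C + - C = 0\<^sub>m m r" "- C + C = 0\<^sub>m m r"
    using C by (auto intro!: eq_matI)
  have "M * U = four_block_mat (1\<^sub>m m) (0\<^sub>m m r) N (1\<^sub>m r + N * C)"
    unfolding M_def U_def using C N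
    by (subst mult_four_block_mat[of _ m m _ r _ r _ _ m _ r])
       (auto simp: CC comm_add_mat[of "N * C" r r])
  hence "Determinant.det M * Determinant.det U = Determinant.det (1\<^sub>m r + N * C)"
    using det_mult[OF M U] N C
    by (simp add: det_four_block_mat_upper_right_zero[of _ m _ r])
  moreover have "U * M = four_block_mat (1\<^sub>m m + C * N) (0\<^sub>m m r) N (1\<^sub>m r)"
    unfolding M_def U_def using C N
    by (subst mult_four_block_mat[of _ m m _ r _ r _ _ m _ r]) (auto simp: CC)
  hence "Determinant.det U * Determinant.det M = Determinant.det (1\<^sub>m m + C * N)"
    using det_mult[OF U M] N C
    by (simp add: det_four_block_mat_upper_right_zero[of _ m _ r])
  ultimately show ?thesis by (simp add: detU)
qed

text \<open>
  If \<open>L C = 1\<close>, then \<open>K \<mapsto> 1 + C (K - 1) L\<close> acts as \<open>K\<close> on the column space of \<open>C\<close> and as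
  the identity on the kernel of \<open>L\<close>.
\<close>

definition inflate :: "'a :: comm_ring_1 mat \<Rightarrow> 'a mat \<Rightarrow> 'a mat \<Rightarrow> 'a mat" where
  "inflate C L K = 1\<^sub>m (dim_row C) + C * (K - 1\<^sub>m (dim_col C)) * L"

context
  fixes C L :: "'a :: idom mat" and m r :: nat
  assumes C: "C \<in> carrier_mat m r" and L: "L \<in> carrier_mat r m" and LC: "L * C = 1\<^sub>m r"
begin

lemma inflate_carrier: "K \<in> carrier_mat r r \<Longrightarrow> inflate C L K \<in> carrier_mat m m"
  using C L by (auto simp: inflate_def)

lemma inflate_altdef: "inflate C L K = 1\<^sub>m m + C * (K - 1\<^sub>m r) * L"
  using C by (simp add: inflate_def)

lemma inflate_one: "inflate C L (1\<^sub>m r) = 1\<^sub>m m"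
proof -
  have N: "1\<^sub>m r - 1\<^sub>m r = (0\<^sub>m r r :: 'a mat)" by (intro eq_matI) auto
  show ?thesis unfolding inflate_altdef N using C L by simp
qed

lemma inflate_mult_left:
  assumes K: "K \<in> carrier_mat r r"
  shows "inflate C L K * C = C * K"
proof -
  define N where "N = K - 1\<^sub>m r"
  have N: "N \<in> carrier_mat r r" by (simp add: N_def minus_carrier_mat)
  have CN: "C * N \<in> carrier_mat m r" using C N by simp
  have CNL: "C * N * L \<in> carrier_mat m m" using CN L by simp
  have "inflate C L K * C = 1\<^sub>m m * C + C * N * L * C"
    unfolding inflate_altdef N_def[symmetric] by (rule add_mult_distrib_mat[OF one_carrier_mat CNL C])
  also have "C * N * L * C = C * N"
    using assoc_mult_mat[OF CN L C] right_mult_one_mat[OF CN] by (simp only: LC)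
  also have "C * N = C * K - C"
    unfolding N_def using mult_minus_distrib_mat[OF C K one_carrier_mat] C by simp
  also have "1\<^sub>m m * C + (C * K - C) = C * K"
    using C K by (intro eq_matI) auto
  finally show ?thesis .
qed

lemma inflate_add:
  assumes K: "K \<in> carrier_mat r r" "K' \<in> carrier_mat r r"
  shows "C * K' * L + inflate C L K = inflate C L (K' + K)"
proof -
  define N where "N = K - 1\<^sub>m r"
  have N: "N \<in> carrier_mat r r" by (simp add: N_def minus_carrier_mat)
  have CK: "C * K' \<in> carrier_mat m r" "C * N \<in> carrier_mat m r" using C N K by auto
  have CKL: "C * K' * L \<in> carrier_mat m m" "C * N * L \<in> carrier_mat m m" using CK L by auto
  have "K' + K - 1\<^sub>m r = K' + N"
    using K by (intro eq_matI) (auto simp: N_def)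
  hence "inflate C L (K' + K) = 1\<^sub>m m + (C * K' * L + C * N * L)"
    unfolding inflate_altdef using mult_add_distrib_mat[OF C K(2) N] add_mult_distrib_mat[OF CK L]
    by simp
  also have "\<dots> = C * K' * L + (1\<^sub>m m + C * N * L)"
    using CKL by (intro eq_matI) auto
  finally show ?thesis unfolding inflate_altdef N_def by simp
qed

lemma inflate_mult:
  assumes K: "K \<in> carrier_mat r r" "K' \<in> carrier_mat r r"
  shows "inflate C L K * inflate C L K' = inflate C L (K * K')"
proof -
  define N where "N = K' - 1\<^sub>m r"
  have N: "N \<in> carrier_mat r r" by (simp add: N_def minus_carrier_mat)
  have I: "inflate C L K \<in> carrier_mat m m" using K by (simp add: inflate_carrier)
  have CN: "C * N \<in> carrier_mat m r" using C N by simp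
  have CNL: "C * N * L \<in> carrier_mat m m" using CN L by simp
  have KK: "K * K' - K \<in> carrier_mat r r" using K by (simp add: minus_carrier_mat)
  have CKKL: "C * (K * K' - K) * L \<in> carrier_mat m m" using C KK L by simp
  have KN: "K * N = K * K' - K"
    unfolding N_def using mult_minus_distrib_mat[OF K one_carrier_mat] K by simp
  have "inflate C L K * (C * N * L) = inflate C L K * C * N * L"
    using assoc_mult_mat[OF I CN L] assoc_mult_mat[OF I C N] by simp
  also have "\<dots> = C * (K * K' - K) * L"
    unfolding inflate_mult_left[OF K(1)] assoc_mult_mat[OF C K(1) N] KN ..
  finally have "inflate C L K * inflate C L K' = inflate C L K + C * (K * K' - K) * L"
    unfolding inflate_altdef[of K'] N_def[symmetric]
    using mult_add_distrib_mat[OF I one_carrier_mat CNL] I by simp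
  also have "\<dots> = C * (K * K' - K) * L + inflate C L K"
    by (rule comm_add_mat[OF I CKKL])
  also have "\<dots> = inflate C L (K * K' - K + K)"
    by (rule inflate_add[OF K(1) KK])
  also have "K * K' - K + K = K * K'"
    using K by (intro eq_matI) auto
  finally show ?thesis .
qed

lemma det_inflate:
  assumes K: "K \<in> carrier_mat r r"
  shows "Determinant.det (inflate C L K) = Determinant.det K"
proof -
  define N where "N = K - 1\<^sub>m r"
  have N: "N \<in> carrier_mat r r" by (simp add: N_def minus_carrier_mat)
  have NL: "N * L \<in> carrier_mat r m" using N L by simp
  have "inflate C L K = 1\<^sub>m m + C * (N * L)"
    unfolding inflate_altdef N_def[symmetric] assoc_mult_mat[OF C N L] ..
  also have "Determinant.det \<dots> = Determinant.det (1\<^sub>m r + N * L * C)"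
    by (rule det_one_plus_mult_commute[OF C NL])
  also have "N * L * C = N"
    using assoc_mult_mat[OF N L C] right_mult_one_mat[OF N] by (simp only: LC)
  also have "1\<^sub>m r + N = K"
    using K by (intro eq_matI) (auto simp: N_def)
  finally show ?thesis .
qed

end

text \<open>
  For \<open>X = C diag(\<epsilon>/\<psi>) F\<close> with \<open>L C = 1\<close> and \<open>F R = 1\<close> the matrix \<open>D\<close> that inflates \<open>diag(\<psi>)\<close> satisfies
  \<open>D X = C diag(\<epsilon>) F\<close>. If \<open>s \<epsilon> + t \<psi> = 1\<close>, then \<open>A = R diag(s) L\<close> and the inflation \<open>B\<close> of \<open>diag(t)\<close>
  witness coprimality.
\<close>

lemma left_denominator_of_smith_mcmillan:
  assumes "is_smith_mcmillan X \<epsilon> \<psi>"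
  shows "\<exists>D. left_denominator (Fin a) X D \<and>
    has_order (Fin a) (Determinant.det D) (\<Sum>p\<leftarrow>\<psi>. Polynomial.order a p)"
  using assms
proof (rule is_smith_mcmillanE)
  fix r C F
  define m n where "m = dim_row X" and "n = dim_col X"
  assume r: "length \<psi> = r"
    and C': "C \<in> carrier_mat (dim_row X) r" and Ci: "left_invertible_polymat C"
    and F': "F \<in> carrier_mat r (dim_col X)" and Fi: "right_invertible_polymat F"
    and X: "X = map_mat to_fract C * diag r (\<lambda>i. Fraction_Field.Fract (\<epsilon> ! i) (\<psi> ! i)) *
      map_mat to_fract F"
    and lead: "\<And>i. i < r \<Longrightarrow> lead_coeff (\<psi> ! i) = 1"
    and cop: "\<And>i. i < r \<Longrightarrow> coprime (\<epsilon> ! i) (\<psi> ! i)"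
  have C: "C \<in> carrier_mat m r" and F: "F \<in> carrier_mat r n"
    using C' F' by (simp_all only: m_def n_def)
  have nz: "\<psi> ! i \<noteq> 0" if "i < r" for i using lead[OF that] by auto
  obtain L where L: "L \<in> carrier_mat r m" "L * C = 1\<^sub>m r"
    using C Ci unfolding left_invertible_polymat_def by auto
  obtain R where R: "R \<in> carrier_mat n r" "F * R = 1\<^sub>m r"
    using F Fi unfolding right_invertible_polymat_def by auto
  define s t where "s i = fst (bezout_coefficients (\<epsilon> ! i) (\<psi> ! i))"
    and "t i = snd (bezout_coefficients (\<epsilon> ! i) (\<psi> ! i))" for i
  have bez: "s i * \<epsilon> ! i + t i * \<psi> ! i = 1" if "i < r" for i
    using bezout_coefficients_fst_snd[of "\<epsilon> ! i" "\<psi> ! i"] cop[OF that]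
    by (simp add: s_def t_def coprime_iff_gcd_eq_1)
  let ?E = "diag r (\<lambda>i. \<epsilon> ! i)" and ?P = "diag r (\<lambda>i. \<psi> ! i)"
  let ?S = "diag r s" and ?T = "diag r t"
  let ?Q = "diag r (\<lambda>i. Fraction_Field.Fract (\<epsilon> ! i) (\<psi> ! i))"
  let ?f = "map_mat to_fract :: complex poly mat \<Rightarrow> ratmat"
  define D where "D = inflate C L ?P"
  have D: "D \<in> carrier_mat m m" unfolding D_def by (rule inflate_carrier[OF C L]) simp
  have PQ: "?f ?P * ?Q = ?f ?E"
    using nz by (simp add: map_mat_diag diag_mult Fract_conv_to_fract cong: diag_cong)
  have "?f D * X = ?f D * ?f C * ?Q * ?f F"
    unfolding X using D C F
    by (simp add: assoc_mult_mat[of _ m r _ r _ n] assoc_mult_mat[of _ m m _ r _ n]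
        assoc_mult_mat[of _ m m _ r _ r])
  also have "?f D * ?f C = ?f (C * ?P)"
    using to_fract.mat_hom_mult[OF D C] inflate_mult_left[OF C L diag_carrier] by (simp add: D_def)
  also have "\<dots> = ?f C * ?f ?P"
    by (rule to_fract.mat_hom_mult[OF C diag_carrier])
  also have "?f C * ?f ?P * ?Q = ?f C * ?f ?E"
    using assoc_mult_mat[of "?f C" m r "?f ?P" r ?Q r] C PQ by simp
  also have "\<dots> * ?f F = ?f (C * ?E * F)"
    using to_fract.mat_hom_mult[OF C diag_carrier] to_fract.mat_hom_mult[of "C * ?E" m r F n] C F by simp
  finally have DX: "?f D * X = ?f (C * ?E * F)" .
  have CEF: "C * ?E * F \<in> carrier_mat m n" using C F by auto
  define A where "A = R * ?S * L"
  define B where "B = inflate C L ?T"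
  have A: "A \<in> carrier_mat n m" using R L by (auto simp: A_def)
  have B: "B \<in> carrier_mat m m" unfolding B_def by (rule inflate_carrier[OF C L]) simp
  have "C * ?E * F * A = C * (?E * ?S) * L"
  proof -
    have "F * A = ?S * L"
      using assoc_mult_mat[of F r n "R * ?S" r L m] assoc_mult_mat[of F r n R r ?S r] F R L
      by (simp add: A_def)
    thus ?thesis
      using assoc_mult_mat[of "C * ?E" m r F n A m] assoc_mult_mat[of "C * ?E" m r ?S r L m]
        assoc_mult_mat[of C m r ?E r ?S r] C F A L by simp
  qed
  moreover have "D * B = inflate C L (?P * ?T)"
    unfolding D_def B_def by (rule inflate_mult[OF C L]) auto
  ultimately have "C * ?E * F * A + D * B = inflate C L (?E * ?S + ?P * ?T)"
    using inflate_add[OF C L, of "?P * ?T" "?E * ?S"] by (simp add: diag_mult)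
  also have "?E * ?S + ?P * ?T = 1\<^sub>m r"
    unfolding diag_mult diag_add using bez by (intro diag_one) (simp add: mult.commute)
  finally have bezout: "C * ?E * F * A + D * B = 1\<^sub>m m"
    by (simp add: inflate_one[OF C L])
  have "?f D * X * ?f A + ?f D * ?f B = ?f (C * ?E * F * A) + ?f (D * B)"
    unfolding DX to_fract.mat_hom_mult[OF CEF A] to_fract.mat_hom_mult[OF D B] ..
  also have "\<dots> = ?f (C * ?E * F * A + D * B)"
    using CEF A D B by (intro eq_matI) auto
  finally have bezout': "?f D * X * ?f A + ?f D * ?f B = 1\<^sub>m m"
    by (simp only: bezout to_fract.mat_hom_one)
  have detD: "Determinant.det D = (\<Prod>i<r. \<psi> ! i)"
    unfolding D_def by (simp add: det_inflate[OF C L] det_diag)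
  have "Determinant.det D \<noteq> 0" unfolding detD using nz by simp
  hence "left_denominator (Fin a) X (?f D)"
    unfolding left_denominator_def m_def[symmetric] n_def[symmetric]
    using D A B bezout' regular_mat_at_to_fract unfolding DX
    by (intro conjI bexI[of _ "?f A"] bexI[of _ "?f B"]) auto
  moreover have "has_order (Fin a) (Determinant.det (?f D)) (\<Sum>p\<leftarrow>\<psi>. Polynomial.order a p)"
  proof -
    have "Polynomial.order a (\<Prod>i<k. \<psi> ! i) = (\<Sum>i<k. Polynomial.order a (\<psi> ! i))" if "k \<le> r" for k
      using that
    proof (induction k)
      case (Suc k)
      have "(\<Prod>i<Suc k. \<psi> ! i) \<noteq> 0" using nz Suc.prems by auto
      thus ?case using Suc by (simp add: order_mult)
    qed simp
    from this[OF order_refl] have "Polynomial.order a (Determinant.det D) = (\<Sum>p\<leftarrow>\<psi>. Polynomial.order a p)"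
      by (simp add: detD sum_list_sum_nth r atLeast0LessThan)
    thus ?thesis
      using has_order_to_fract[OF \<open>Determinant.det D \<noteq> 0\<close>, of a] by simp
  qed
  ultimately show ?thesis by blast
qed

lemma left_denominator_exists:
  "\<exists>D. left_denominator \<alpha> X D \<and> has_order \<alpha> (Determinant.det D) (pole_degree X \<alpha>)"
proof (cases \<alpha>)
  case (Fin a)
  thus ?thesis
    using left_denominator_of_smith_mcmillan[OF is_smith_mcmillan_sm] by simp
next
  case Inf
  obtain D where D: "left_denominator (Fin 0) (ratmat_recip X) D"
      "has_order (Fin 0) (Determinant.det D) (pole_degree X Inf)"
    using left_denominator_of_smith_mcmillan[OF is_smith_mcmillan_sm, of 0 "ratmat_recip X"] by auto
  have "left_denominator Inf X (ratmat_recip D)"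
    using left_denominator_ratmat_recip_imp[OF D(1)] by simp
  moreover have "has_order Inf (Determinant.det (ratmat_recip D)) (pole_degree X Inf)"
    using D(2) by (simp add: det_ratmat_recip has_order_ratfun_recip)
  ultimately show ?thesis unfolding Inf by blast
qed

lemma pole_degree_eq:
  assumes "left_denominator \<alpha> X D" "has_order \<alpha> (Determinant.det D) k"
  shows "pole_degree X \<alpha> = k"
  using left_denominator_exists[of \<alpha> X] left_denominator_order_unique assms by blast

lemma pole_degree_ratmat_recip: "pole_degree (ratmat_recip X) \<alpha> = pole_degree X (einverse \<alpha>)"
proof -
  obtain D where D: "left_denominator (einverse \<alpha>) X D"
    "has_order (einverse \<alpha>) (Determinant.det D) (pole_degree X (einverse \<alpha>))"
    using left_denominator_exists by blast
  have "left_denominator \<alpha> (ratmat_recip X) (ratmat_recip D)"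
    using left_denominator_ratmat_recip_imp[OF D(1)] by simp
  moreover have "has_order \<alpha> (Determinant.det (ratmat_recip D)) (pole_degree X (einverse \<alpha>))"
    using D(2) by (simp add: det_ratmat_recip has_order_ratfun_recip)
  ultimately show ?thesis by (rule pole_degree_eq)
qed

lemma pole_degree_transpose: "pole_degree X\<^sup>T \<alpha> = pole_degree X \<alpha>"
proof -
  have *: "pole_degree X\<^sup>T (Fin a) = pole_degree X (Fin a)" for X a
  proof -
    obtain D where "left_denominator (Fin a) X\<^sup>T D"
      "has_order (Fin a) (Determinant.det D) (pole_degree X (Fin a))"
      using left_denominator_of_smith_mcmillan[OF is_smith_mcmillan_transpose[OF is_smith_mcmillan_sm]]
      by fastforce
    thus ?thesis by (rule pole_degree_eq)
  qed
  show ?thesis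
  proof (cases \<alpha>)
    case Inf
    have "pole_degree Y Inf = pole_degree (ratmat_recip Y) (Fin 0)" for Y by simp
    thus ?thesis unfolding Inf using *[of "ratmat_recip X" 0] by (simp only: ratmat_recip_transpose)
  qed (use * in blast)
qed

lemma pole_degree_regular:
  assumes "regular_mat_at \<alpha> X"
  shows "pole_degree X \<alpha> = 0"
proof (rule pole_degree_eq)
  define m n where "m = dim_row X" and "n = dim_col X"
  have X: "X \<in> carrier_mat m n" by (auto simp: m_def n_def)
  show "left_denominator \<alpha> X (1\<^sub>m m)"
    unfolding left_denominator_def m_def[symmetric] n_def[symmetric] using X assms
    by (intro conjI bexI[of _ "0\<^sub>m n m"] bexI[of _ "1\<^sub>m m"])
       (auto simp: regular_mat_at_one regular_mat_at_zero)
  show "has_order \<alpha> (Determinant.det (1\<^sub>m m :: ratmat)) 0"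
    by (simp add: has_order_0_iff unit_at_def)
qed

lemma pole_degree_mult_le:
  assumes "M \<in> carrier_mat m k" "W \<in> carrier_mat k n" "regular_mat_at \<alpha> W"
  shows "pole_degree (M * W) \<alpha> \<le> pole_degree M \<alpha>"
  using left_denominator_exists[of \<alpha> M] left_denominator_exists[of \<alpha> "M * W"]
    left_denominator_mult(1)[OF assms] by blast

lemma pole_degree_mult_eq:
  assumes "M \<in> carrier_mat m k" "W \<in> carrier_mat k n" "regular_mat_at \<alpha> W"
    and "pole_degree (M * W) \<alpha> = pole_degree M \<alpha>"
  obtains Y Z where "Y \<in> carrier_mat n k" "Z \<in> carrier_mat m k"
    "regular_mat_at \<alpha> Y" "regular_mat_at \<alpha> Z" "M = M * W * Y + Z"
proof -
  obtain D where D: "left_denominator \<alpha> M D" "has_order \<alpha> (Determinant.det D) (pole_degree M \<alpha>)"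
    using left_denominator_exists by blast
  obtain D' where D': "left_denominator \<alpha> (M * W) D'"
    "has_order \<alpha> (Determinant.det D') (pole_degree M \<alpha>)"
    using left_denominator_exists[of \<alpha> "M * W"] assms(4) by auto
  show thesis
    using left_denominator_mult(2)[OF assms(1-3) D D' refl] that by blast
qed

text \<open>The largest denominator comes first, so a pole is a point of nonzero pole degree.\<close>

lemma is_ratmat_pole_iff: "is_ratmat_pole G \<alpha> \<longleftrightarrow> pole_degree G \<alpha> \<noteq> 0"
proof -
  have *: "(sm_den G \<noteq> [] \<and> poly (hd (sm_den G)) a = 0) \<longleftrightarrow>
      (\<Sum>p\<leftarrow>sm_den G. Polynomial.order a p) \<noteq> 0" for G a
    using is_smith_mcmillan_sm[of G]
  proof (rule is_smith_mcmillanE)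
    fix r
    let ?p = "sm_den G"
    assume len: "length ?p = r" and lead: "\<And>i. i < r \<Longrightarrow> lead_coeff (?p ! i) = 1"
      and dvd: "\<And>i. Suc i < r \<Longrightarrow> ?p ! Suc i dvd ?p ! i"
    have root: "poly (?p ! i) a = 0 \<longleftrightarrow> Polynomial.order a (?p ! i) \<noteq> 0" if "i < r" for i
      using lead[OF that] order_root[of "?p ! i" a] by auto
    have hd: "?p ! i dvd ?p ! 0" if "i < r" for i
      using that
    proof (induction i)
      case (Suc i)
      thus ?case using dvd[of i] dvd_trans by (metis Suc_lessD)
    qed simp
    have "(\<Sum>p\<leftarrow>?p. Polynomial.order a p) \<noteq> 0 \<longleftrightarrow> (\<exists>p\<in>set ?p. Polynomial.order a p \<noteq> 0)"
      by (auto simp: sum_list_eq_0_iff)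
    also have "\<dots> \<longleftrightarrow> (\<exists>i<r. Polynomial.order a (?p ! i) \<noteq> 0)"
      using len by (metis in_set_conv_nth)
    also have "\<dots> \<longleftrightarrow> (\<exists>i<r. poly (?p ! i) a = 0)" using root by blast
    also have "\<dots> \<longleftrightarrow> 0 < r \<and> poly (?p ! 0) a = 0"
      using hd by (metis dvd_trans gr_zeroI not_less_zero poly_eq_0_iff_dvd)
    also have "\<dots> \<longleftrightarrow> ?p \<noteq> [] \<and> poly (hd ?p) a = 0"
      using len by (cases ?p) auto
    finally show ?thesis by blast
  qed
  show ?thesis using * by (cases \<alpha>) simp_all
qed

lemma finite_poles: "finite {\<alpha>. is_ratmat_pole G \<alpha>}"
proof (cases "sm_den G = []")
  case True
  hence "{\<alpha>. is_ratmat_pole G \<alpha>} \<subseteq> {Inf}"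
    by (metis (mono_tags, lifting) ecomplex.exhaust insertI1 is_ratmat_pole.simps(1) mem_Collect_eq
        subsetI)
  thus ?thesis using finite_subset by blast
next
  case False
  have "hd (sm_den G) \<noteq> 0"
    using is_smith_mcmillan_sm[of G]
  proof (rule is_smith_mcmillanE)
    fix r
    assume len: "length (sm_den G) = r" and lead: "\<And>i. i < r \<Longrightarrow> lead_coeff (sm_den G ! i) = 1"
    have "lead_coeff (hd (sm_den G)) = 1"
    proof -
      have "0 < r" using len False by (metis length_greater_0_conv)
      thus ?thesis using lead False by (simp add: hd_conv_nth)
    qed
    thus ?thesis by auto
  qed
  moreover have "{\<alpha>. is_ratmat_pole G \<alpha>} \<subseteq> insert Inf (Fin ` {a. poly (hd (sm_den G)) a = 0})"
  proof
    fix \<alpha> assume "\<alpha> \<in> {\<alpha>. is_ratmat_pole G \<alpha>}"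
    thus "\<alpha> \<in> insert Inf (Fin ` {a. poly (hd (sm_den G)) a = 0})" by (cases \<alpha>) auto
  qed
  ultimately show ?thesis
    using poly_roots_finite finite_subset by (metis finite_imageI finite_insert)
qed

lemma mcmillan_degree_eq_sum:
  assumes "finite S" "{\<alpha>. is_ratmat_pole G \<alpha>} \<subseteq> S"
  shows "mcmillan_degree G = (\<Sum>\<alpha>\<in>S. pole_degree G \<alpha>)"
  unfolding mcmillan_degree_def
  by (rule sum.mono_neutral_left[OF assms]) (simp add: is_ratmat_pole_iff)


section \<open>Minimal spectral factors\<close>

text \<open>The matrix \<open>G\<^sup>~\<close>. It omits the conjugation of the coefficients, so it agrees with \<open>G\<^sup>*\<close> for real \<open>G\<close>.\<close>

definition recip_transpose :: "ratmat \<Rightarrow> ratmat" where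
  "recip_transpose G = (ratmat_recip G)\<^sup>T"

lemma para_adjoint_real: "real_ratmat G \<Longrightarrow> para_adjoint G = recip_transpose G"
  by (intro eq_matI) (auto simp: para_adjoint_def recip_transpose_def ratmat_recip_def
      real_ratmat_def ratfun_cnj_real)

lemma recip_transpose_carrier [simp]:
  "recip_transpose G \<in> carrier_mat n m \<longleftrightarrow> G \<in> carrier_mat m n"
  by (simp add: recip_transpose_def)

lemma recip_transpose_recip_transpose [simp]: "recip_transpose (recip_transpose G) = G"
  by (simp add: recip_transpose_def ratmat_recip_transpose)

lemma recip_transpose_one [simp]: "recip_transpose (1\<^sub>m n) = 1\<^sub>m n"
  by (simp add: recip_transpose_def)

lemma recip_transpose_mult:
  assumes "G \<in> carrier_mat m k" "H \<in> carrier_mat k n"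
  shows "recip_transpose (G * H) = recip_transpose H * recip_transpose G"
  unfolding recip_transpose_def ratmat_recip_mult[OF assms]
  by (rule transpose_mult) (use assms in simp_all)

lemma regular_mat_at_recip_transpose:
  "regular_mat_at \<alpha> (recip_transpose G) \<longleftrightarrow> regular_mat_at (einverse \<alpha>) G"
  by (simp add: recip_transpose_def regular_mat_at_transpose regular_mat_at_ratmat_recip)

lemma pole_degree_recip_transpose:
  "pole_degree (recip_transpose G) \<alpha> = pole_degree G (einverse \<alpha>)"
  by (simp add: recip_transpose_def pole_degree_transpose pole_degree_ratmat_recip)

lemma weakly_unmixed_symplectic_cover:
  "weakly_unmixed_symplectic A \<Longrightarrow> \<alpha> \<in> A \<or> einverse \<alpha> \<in> A"
  by (auto simp: weakly_unmixed_symplectic_def star_set_def)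

text \<open>
  Where \<open>W\<close> is regular, \<open>\<Phi> = W\<^sup>~ W\<close> has at most the pole degree of \<open>W\<^sup>~\<close>. Stochastic minimality says
  that all these estimates, summed up, are equalities; hence each of them is.
\<close>

lemma minimal_pole_degree:
  assumes W: "W \<in> carrier_mat r n" and \<Phi>: "\<Phi> = recip_transpose W * W"
    and cover: "\<And>\<alpha>. \<alpha> \<in> A \<or> einverse \<alpha> \<in> A"
    and reg: "\<And>\<alpha>. \<alpha> \<in> A \<Longrightarrow> regular_mat_at \<alpha> W"
    and min: "mcmillan_degree \<Phi> = 2 * mcmillan_degree W"
    and \<alpha>: "\<alpha> \<in> A"
  shows "pole_degree \<Phi> \<alpha> = pole_degree (recip_transpose W) \<alpha>"
proof -
  define f g where "f \<beta> = pole_degree \<Phi> \<beta>" and "g \<beta> = pole_degree W \<beta>" for \<beta>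
  have W': "recip_transpose W \<in> carrier_mat n r" using W by simp
  have "recip_transpose \<Phi> = \<Phi>"
    unfolding \<Phi> recip_transpose_mult[OF W' W] by simp
  hence f_sym: "f (einverse \<beta>) = f \<beta>" for \<beta>
    using pole_degree_recip_transpose[of \<Phi> \<beta>] by (simp add: f_def)
  have f_le: "f \<beta> \<le> g (einverse \<beta>)" if "\<beta> \<in> A" for \<beta>
    using pole_degree_mult_le[OF W' W reg[OF that]]
    by (simp add: f_def g_def \<Phi> pole_degree_recip_transpose)
  have le: "f \<beta> \<le> g \<beta> + g (einverse \<beta>)" for \<beta>
    using cover[of \<beta>] f_le[of \<beta>] f_le[of "einverse \<beta>"] f_sym[of \<beta>] by auto
  \<comment> \<open>A finite set of points that is closed under reflection and contains all poles.\<close>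
  define P where "P = {\<beta>. is_ratmat_pole \<Phi> \<beta>} \<union> {\<beta>. is_ratmat_pole W \<beta>}"
  define S where "S = P \<union> einverse ` P"
  have S: "finite S" "P \<subseteq> S" "einverse ` S = S"
    by (auto simp: S_def P_def finite_poles image_Un image_image)
  have inj: "inj_on einverse S" by (metis einverse_einverse inj_onI)
  have "(\<Sum>\<beta>\<in>S. f \<beta>) = 2 * (\<Sum>\<beta>\<in>S. g \<beta>)"
    using min mcmillan_degree_eq_sum[OF S(1), of \<Phi>] mcmillan_degree_eq_sum[OF S(1), of W] S(2)
    by (simp add: P_def f_def g_def)
  also have "(\<Sum>\<beta>\<in>S. g \<beta>) = (\<Sum>\<beta>\<in>S. g (einverse \<beta>))"
    using sum.reindex[OF inj, of g] S(3) by simp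
  hence "2 * (\<Sum>\<beta>\<in>S. g \<beta>) = (\<Sum>\<beta>\<in>S. g \<beta> + g (einverse \<beta>))"
    by (simp add: sum.distrib)
  finally have sums: "(\<Sum>\<beta>\<in>S. f \<beta>) = (\<Sum>\<beta>\<in>S. g \<beta> + g (einverse \<beta>))" .
  have "f \<alpha> = g \<alpha> + g (einverse \<alpha>)"
  proof (cases "\<alpha> \<in> S")
    case True
    show ?thesis by (rule sum_mono_inv[OF sums le True S(1)])
  next
    case False
    hence "\<alpha> \<notin> P" "einverse \<alpha> \<notin> P"
      unfolding S_def by (auto intro: image_eqI[of _ _ "einverse \<alpha>"])
    thus ?thesis by (simp add: P_def is_ratmat_pole_iff f_def g_def)
  qed
  moreover have "g \<alpha> = 0"
    using pole_degree_regular[OF reg[OF \<alpha>]] by (simp add: g_def)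
  ultimately show ?thesis
    by (simp add: f_def g_def pole_degree_recip_transpose)
qed

text \<open>Two right invertible factors of the same \<open>\<Phi>\<close> differ by an all-pass factor.\<close>

lemma spectral_factor_quotient:
  assumes W: "W \<in> carrier_mat r n" and W\<^sub>1: "W\<^sub>1 \<in> carrier_mat r n"
    and V: "V \<in> carrier_mat n r" "W * V = 1\<^sub>m r" and V\<^sub>1: "V\<^sub>1 \<in> carrier_mat n r" "W\<^sub>1 * V\<^sub>1 = 1\<^sub>m r"
    and eq: "recip_transpose W\<^sub>1 * W\<^sub>1 = recip_transpose W * W"
  shows "W\<^sub>1 * V = recip_transpose (W * V\<^sub>1)" and "W\<^sub>1 = W\<^sub>1 * V * W"
proof -
  have W': "recip_transpose W \<in> carrier_mat n r" "recip_transpose W\<^sub>1 \<in> carrier_mat n r"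
    and V': "recip_transpose V\<^sub>1 \<in> carrier_mat r n" using W W\<^sub>1 V\<^sub>1 by simp_all
  have VW: "recip_transpose V\<^sub>1 * recip_transpose W\<^sub>1 = 1\<^sub>m r"
    using recip_transpose_mult[OF W\<^sub>1 V\<^sub>1(1)] by (simp add: V\<^sub>1(2))
  have S: "recip_transpose (W * V\<^sub>1) \<in> carrier_mat r r" using W V\<^sub>1 by simp
  have "W\<^sub>1 = recip_transpose V\<^sub>1 * recip_transpose W\<^sub>1 * W\<^sub>1"
    using W\<^sub>1 by (simp add: VW)
  also have "\<dots> = recip_transpose V\<^sub>1 * (recip_transpose W * W)"
    using assoc_mult_mat[OF V' W'(2) W\<^sub>1] by (simp add: eq)
  also have "\<dots> = recip_transpose (W * V\<^sub>1) * W"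
    unfolding recip_transpose_mult[OF W V\<^sub>1(1)] by (rule assoc_mult_mat[OF V' W'(1) W, symmetric])
  finally have *: "W\<^sub>1 = recip_transpose (W * V\<^sub>1) * W" .
  have "W\<^sub>1 * V = recip_transpose (W * V\<^sub>1) * (W * V)"
    by (subst *) (rule assoc_mult_mat[OF S W V(1)])
  also have "\<dots> = recip_transpose (W * V\<^sub>1)" using right_mult_one_mat[OF S] by (simp add: V(2))
  finally show "W\<^sub>1 * V = recip_transpose (W * V\<^sub>1)" .
  with * show "W\<^sub>1 = W\<^sub>1 * V * W" by simp
qed

text \<open>
  If \<open>V\<close> is regular at \<open>\<alpha>\<close>, so is \<open>W\<^sub>1 V\<close>. Otherwise \<open>V\<^sub>1\<^sup>~\<close> is, and minimality gives
  \<open>W\<^sup>~ = \<Phi> Y + Z\<close> with \<open>Y, Z\<close> regular at \<open>\<alpha>\<close>, whence \<open>W\<^sub>1 V = V\<^sub>1\<^sup>~ W\<^sup>~ = W\<^sub>1 Y + V\<^sub>1\<^sup>~ Z\<close>.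
\<close>

lemma spectral_factor_quotient_regular:
  assumes W: "W \<in> carrier_mat r n" and W\<^sub>1: "W\<^sub>1 \<in> carrier_mat r n"
    and V: "V \<in> carrier_mat n r" "W * V = 1\<^sub>m r" and V\<^sub>1: "V\<^sub>1 \<in> carrier_mat n r" "W\<^sub>1 * V\<^sub>1 = 1\<^sub>m r"
    and eq: "recip_transpose W\<^sub>1 * W\<^sub>1 = recip_transpose W * W"
    and reg: "regular_mat_at \<alpha> W" "regular_mat_at \<alpha> W\<^sub>1"
    and min: "pole_degree (recip_transpose W * W) \<alpha> = pole_degree (recip_transpose W) \<alpha>"
    and regV: "regular_mat_at \<alpha> V \<or> regular_mat_at (einverse \<alpha>) V\<^sub>1"
  shows "regular_mat_at \<alpha> (W\<^sub>1 * V)"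
  using regV
proof
  assume "regular_mat_at \<alpha> V"
  thus ?thesis using reg(2) W\<^sub>1 V(1) by (intro regular_mat_at_mult) auto
next
  assume "regular_mat_at (einverse \<alpha>) V\<^sub>1"
  hence regV': "regular_mat_at \<alpha> (recip_transpose V\<^sub>1)"
    by (simp add: regular_mat_at_recip_transpose)
  have W': "recip_transpose W \<in> carrier_mat n r" "recip_transpose W\<^sub>1 \<in> carrier_mat n r"
    and V': "recip_transpose V\<^sub>1 \<in> carrier_mat r n" using W W\<^sub>1 V\<^sub>1 by simp_all
  obtain Y Z where YZ: "Y \<in> carrier_mat n r" "Z \<in> carrier_mat n r"
      "regular_mat_at \<alpha> Y" "regular_mat_at \<alpha> Z"
    and dec: "recip_transpose W = recip_transpose W * W * Y + Z"
    using pole_degree_mult_eq[OF W'(1) W reg(1) min] by blast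
  have VW: "recip_transpose V\<^sub>1 * recip_transpose W\<^sub>1 = 1\<^sub>m r"
    using recip_transpose_mult[OF W\<^sub>1 V\<^sub>1(1)] by (simp add: V\<^sub>1(2))
  have WY: "W\<^sub>1 * Y \<in> carrier_mat r r" using W\<^sub>1 YZ by simp
  have WWY: "recip_transpose W\<^sub>1 * (W\<^sub>1 * Y) \<in> carrier_mat n r" using W'(2) WY by simp
  have "recip_transpose W = recip_transpose W\<^sub>1 * (W\<^sub>1 * Y) + Z"
    using dec assoc_mult_mat[OF W'(2) W\<^sub>1 YZ(1)] by (simp add: eq)
  hence "recip_transpose V\<^sub>1 * recip_transpose W =
      recip_transpose V\<^sub>1 * (recip_transpose W\<^sub>1 * (W\<^sub>1 * Y)) + recip_transpose V\<^sub>1 * Z"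
    using mult_add_distrib_mat[OF V' WWY YZ(2)] by simp
  also have "recip_transpose V\<^sub>1 * (recip_transpose W\<^sub>1 * (W\<^sub>1 * Y)) = W\<^sub>1 * Y"
    using assoc_mult_mat[OF V' W'(2) WY] left_mult_one_mat[OF WY] by (simp add: VW)
  finally have "W\<^sub>1 * V = W\<^sub>1 * Y + recip_transpose V\<^sub>1 * Z"
    using spectral_factor_quotient(1)[OF W W\<^sub>1 V V\<^sub>1 eq] recip_transpose_mult[OF W V\<^sub>1(1)] by simp
  moreover have "regular_mat_at \<alpha> (W\<^sub>1 * Y + recip_transpose V\<^sub>1 * Z)"
    using reg YZ regV' W\<^sub>1 V'
    by (intro regular_mat_at_add regular_mat_at_mult[of _ "W\<^sub>1"]
        regular_mat_at_mult[of _ "recip_transpose V\<^sub>1"]) auto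
  ultimately show ?thesis by simp
qed

theorem theorem1:
  fixes \<Phi> W W\<^sub>1 V V\<^sub>1 :: ratmat and A\<^sub>p A\<^sub>z :: "ecomplex set" and n r :: nat
  assumes "is_spectrum n \<Phi>" and "normal_rank \<Phi> = r" and "r \<le> n" and "r \<noteq> 0"
    and "weakly_unmixed_symplectic A\<^sub>p" and "weakly_unmixed_symplectic A\<^sub>z"
    and "W \<in> carrier_mat r n" and "W\<^sub>1 \<in> carrier_mat r n"
    and "spectral_factor \<Phi> W" and "spectral_factor \<Phi> W\<^sub>1"
    and "ratmat_analytic_on W A\<^sub>p" and "ratmat_analytic_on W\<^sub>1 A\<^sub>p"
    and "minimal_right_inverse W V" and "minimal_right_inverse W\<^sub>1 V\<^sub>1"
    and "ratmat_analytic_on V A\<^sub>z" and "ratmat_analytic_on V\<^sub>1 A\<^sub>z"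
    and "stochastically_minimal \<Phi> W" and "stochastically_minimal \<Phi> W\<^sub>1"
  shows "\<exists>T :: real Matrix.mat. T \<in> carrier_mat r r \<and>
           transpose_mat T * T = 1\<^sub>m r \<and> T * transpose_mat T = 1\<^sub>m r \<and>
           W\<^sub>1 = map_mat (\<lambda>x. const_ratfun (complex_of_real x)) T * W"
proof -
  note W = assms(7) and W\<^sub>1 = assms(8)
  have \<Phi>: "\<Phi> = recip_transpose W * W" "\<Phi> = recip_transpose W\<^sub>1 * W\<^sub>1"
    and real: "real_ratmat W" "real_ratmat W\<^sub>1"
    using assms(9,10) by (auto simp: spectral_factor_def para_adjoint_real)
  have V: "V \<in> carrier_mat n r" "W * V = 1\<^sub>m r" and V\<^sub>1: "V\<^sub>1 \<in> carrier_mat n r" "W\<^sub>1 * V\<^sub>1 = 1\<^sub>m r"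
    using assms(13,14) W W\<^sub>1 by (auto simp: minimal_right_inverse_def)
  have eq: "recip_transpose W\<^sub>1 * W\<^sub>1 = recip_transpose W * W" using \<Phi> by simp
  have cover_p: "\<alpha> \<in> A\<^sub>p \<or> einverse \<alpha> \<in> A\<^sub>p" and cover_z: "\<alpha> \<in> A\<^sub>z \<or> einverse \<alpha> \<in> A\<^sub>z" for \<alpha>
    using assms(5,6) by (simp_all add: weakly_unmixed_symplectic_cover)
  have reg: "regular_mat_at \<alpha> W" "regular_mat_at \<alpha> W\<^sub>1" if "\<alpha> \<in> A\<^sub>p" for \<alpha>
    using assms(11,12) that by (simp_all add: regular_mat_at_of_analytic)
  have regV: "regular_mat_at \<alpha> V" "regular_mat_at \<alpha> V\<^sub>1" if "\<alpha> \<in> A\<^sub>z" for \<alpha>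
    using assms(15,16) that by (simp_all add: regular_mat_at_of_analytic)
  have min: "mcmillan_degree \<Phi> = 2 * mcmillan_degree W" "mcmillan_degree \<Phi> = 2 * mcmillan_degree W\<^sub>1"
    using assms(17,18) by (simp_all add: stochastically_minimal_def)
  define S where "S = W\<^sub>1 * V"
  define S' where "S' = W * V\<^sub>1"
  have S: "S \<in> carrier_mat r r" and S': "S' \<in> carrier_mat r r"
    using W W\<^sub>1 V V\<^sub>1 by (auto simp: S_def S'_def)
  have SS': "S = recip_transpose S'" "W\<^sub>1 = S * W"
    using spectral_factor_quotient[OF W W\<^sub>1 V V\<^sub>1 eq] by (simp_all add: S_def S'_def)
  have SW\<^sub>1: "W = S' * W\<^sub>1"
    using spectral_factor_quotient(2)[OF W\<^sub>1 W V\<^sub>1 V eq[symmetric]] by (simp add: S'_def)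
  have regS: "regular_mat_at \<alpha> S" "regular_mat_at \<alpha> S'" if \<alpha>: "\<alpha> \<in> A\<^sub>p" for \<alpha>
  proof -
    have m: "pole_degree \<Phi> \<alpha> = pole_degree (recip_transpose W) \<alpha>"
      by (rule minimal_pole_degree[OF W \<Phi>(1) cover_p reg(1) min(1) \<alpha>])
    have m\<^sub>1: "pole_degree \<Phi> \<alpha> = pole_degree (recip_transpose W\<^sub>1) \<alpha>"
      by (rule minimal_pole_degree[OF W\<^sub>1 \<Phi>(2) cover_p reg(2) min(2) \<alpha>])
    show "regular_mat_at \<alpha> S"
      unfolding S_def using cover_z[of \<alpha>] regV reg[OF \<alpha>] m \<Phi>
      by (intro spectral_factor_quotient_regular[OF W W\<^sub>1 V V\<^sub>1 eq]) auto
    show "regular_mat_at \<alpha> S'"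
      unfolding S'_def using cover_z[of \<alpha>] regV reg[OF \<alpha>] m\<^sub>1 \<Phi>
      by (intro spectral_factor_quotient_regular[OF W\<^sub>1 W V\<^sub>1 V eq[symmetric]]) auto
  qed
  have "regular_mat_at \<alpha> S" for \<alpha>
    using cover_p[of \<alpha>] regS SS'(1) by (auto simp: regular_mat_at_recip_transpose)
  hence "\<forall>ij. \<exists>c. fst ij < r \<and> snd ij < r \<longrightarrow> S $$ ij = const_ratfun c"
    using regular_everywhere_const S unfolding regular_mat_at_def by fastforce
  then obtain c where c: "S $$ (i, j) = const_ratfun (c (i, j))" if "i < r" "j < r" for i j
    unfolding choice_iff by auto
  \<comment> \<open>\<open>S\<close> is real since it is determined by the real equation \<open>W\<^sub>1 = S W\<close>.\<close>
  have "map_mat ratfun_cnj S = S"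
  proof -
    have cnj: "map_mat ratfun_cnj G = G" if "real_ratmat G" for G
      using that by (intro eq_matI) (auto simp: real_ratmat_def ratfun_cnj_real)
    have cS: "map_mat ratfun_cnj S \<in> carrier_mat r r" using S by simp
    have "W\<^sub>1 = map_mat ratfun_cnj S * W"
      using ratfun_cnj.mat_hom_mult[OF S W] cnj[OF real(1)] cnj[OF real(2)] SS'(2) by metis
    hence "W\<^sub>1 * V = map_mat ratfun_cnj S * (W * V)"
      using assoc_mult_mat[OF cS W V(1)] by simp
    thus ?thesis using right_mult_one_mat[OF cS] by (simp add: V(2) S_def)
  qed
  hence real_c: "complex_of_real (Re (c (i, j))) = c (i, j)" if "i < r" "j < r" for i j
  proof -
    have "ratfun_cnj (S $$ (i, j)) = S $$ (i, j)"
      using \<open>map_mat ratfun_cnj S = S\<close> S that by (metis carrier_matD index_map_mat(1))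
    hence "cnj (c (i, j)) = c (i, j)"
      using c[OF that] by (simp add: ratfun_cnj_const)
    thus ?thesis by (simp add: complex_eq_iff)
  qed
  define T where "T = Matrix.mat r r (\<lambda>ij. Re (c ij))"
  define h where "h x = const_ratfun (complex_of_real x)" for x
  have T: "T \<in> carrier_mat r r" by (simp add: T_def)
  have ST: "S = map_mat h T"
    using S c real_c by (intro eq_matI) (auto simp: T_def h_def)
  interpret h: inj_ring_hom h
    by unfold_locales
       (auto simp: h_def const_ratfun.hom_add const_ratfun.hom_mult)
  have "map_mat h (T\<^sup>T * T) = map_mat h T\<^sup>T * map_mat h T"
    by (rule h.mat_hom_mult[of _ r r _ r]) (use T in simp_all)
  also have "map_mat h T\<^sup>T = S'"
  proof -
    have "S' = recip_transpose S" by (simp add: SS'(1))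
    thus ?thesis
      unfolding ST using T by (intro eq_matI) (auto simp: recip_transpose_def ratmat_recip_def h_def)
  qed
  also have "S' * map_mat h T = 1\<^sub>m r"
  proof -
    have "S' * S * W = W"
      using assoc_mult_mat[OF S' S W] unfolding SS'(2)[symmetric] SW\<^sub>1[symmetric] .
    hence "S' * S * (W * V) = W * V"
      using assoc_mult_mat[of "S' * S" r r W n V r] S S' W V(1) by simp
    thus ?thesis
      using right_mult_one_mat[of "S' * S" r r] S S' by (simp add: V(2) flip: ST)
  qed
  also have "\<dots> = map_mat h (1\<^sub>m r)" by (simp add: h.mat_hom_one)
  finally have TT: "T\<^sup>T * T = 1\<^sub>m r" by (rule h.mat_hom_inj)
  moreover have "T * T\<^sup>T = 1\<^sub>m r"
    by (rule mat_mult_left_right_inverse[OF _ T TT]) (use T in simp)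
  moreover have "W\<^sub>1 = map_mat (\<lambda>x. const_ratfun (complex_of_real x)) T * W"
    using SS'(2) unfolding ST h_def .
  ultimately show ?thesis using T by blast
qed

end
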